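(* Let $H<0$, $K<0$, $\Theta^*>0$ and set $s^*=\Theta^*$. Then, for all sufficiently large $c>0$, the average closed-loop system $$\dot\vartheta_{\rm av}(t)=-\partial_x u_{\rm av}(s_{\rm av}(t),t),$$ $$\partial_t u_{\rm av}(x,t)=\partial_{xx}u_{\rm av}(x,t),\qquad x\in(0,s_{\rm av}(t)),$$ $$u_{\rm av}(s_{\rm av}(t),t)=0,$$ $$\frac{d}{dt}\,\partial_x u_{\rm av}(0,t)=-c\,\partial_x u_{\rm av}(0,t)+cKH\left[\vartheta_{\rm av}(t)+\int_0^{s_{\rm av}(t)}u_{\rm av}(x,t)\,dx\right],$$ with moving boundary $s_{\rm av}(t)=\Theta^*+\vartheta_{\rm av}(t)$, is exponentially stable in the following sense. There exist constants $M,n>0$ such that every solution of this system whose initial data $(T_{\rm av}(\cdot,0),s_0)$, $s_0=s_{\rm av}(0)$, are compatible with the control law, and which satisfies the model validity conditions $$T_{\rm av}(x,t)>T_m\quad\text{for all }x\in(0,s_{\rm av}(t)),\ t\ge 0,$$ $$\dot s_{\rm av}(t)>0\quad\text{for all }t\ge 0,$$ $$s_0<s_{\rm av}(t)<s^*\quad\text{for all }t>0,\qquad s_0<s^*,$$ obeys $$\|u_{\rm av}(t)\|_{\mathcal H_1}^2+|\vartheta_{\rm av}(t)|^2\le M\left(\|u_{\rm av}(0)\|_{\mathcal H_1}^2+\vartheta_{\rm av}(0)^2\right)e^{-nt}\qquad\text{for all }t\ge 0.$$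
   Context: Norm: $\|u_{\rm av}(t)\|_{\mathcal H_1}^2=\int_0^{s_{\rm av}(t)}u_{\rm av}(x,t)^2\,dx+\int_0^{s_{\rm av}(t)}(\partial_x u_{\rm av}(x,t))^2\,dx$, the spatial norm on the current domain $[0,s_{\rm av}(t)]$. Origin of the system (extremum seeking for the one-phase Stefan problem with normalized physical constants). The liquid temperature $T(x,t)$, with melting temperature $T_m$, is written $\alpha(x,t)=T(x,t)-T_m$ and satisfies $\partial_t\alpha=\partial_{xx}\alpha$ on $x\in(0,s(t))$, $\alpha(s(t),t)=0$, $-\partial_x\alpha(0,t)=\theta(t)$ (the input), $\dot s(t)=-\partial_x\alpha(s(t),t)$. The interface position $\Theta(t)=s(t)$ is the input of an unknown quadratic map $y(t)=y^*+\frac H2(\Theta(t)-\Theta^* )^2$ with maximizer $\Theta^*$ and Hessian $H<0$. A probing signal $S(t)=-\partial_x\beta(0,t)$ is added to the input, where $\partial_t\beta=\partial_{xx}\beta$ on $(0,s(t))$, $\beta(s(t),t)=0$, $\partial_x\beta(s(t),t)=-a\omega\cos(\omega t)$. Set $u=\alpha-\beta$, $\vartheta(t)=\Theta(t)-a\sin(\omega t)-\Theta^*$ and $U(t)=\theta(t)-S(t)$. Then the error system is $\dot\vartheta=-\partial_xu(s(t),t)$, $\partial_tu=\partial_{xx}u$, $u(s(t),t)=0$, $-\partial_xu(0,t)=U(t)$. The control law is the low-pass-filtered feedback (filter with transfer function $\frac{c}{\mathsf s+c}$, where $\mathsf s$ is the Laplace variable) $$U(t)=\frac{c}{\mathsf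 s+c}\left\{-K\left[G(t)+\hat H(t)\int_0^{s(t)}u(x,t)\,dx\right]\right\},$$ with gain $K<0$, $G(t)=\frac2a\sin(\omega t)\,y(t)$ and $\hat H(t)=-\frac8{a^2}\cos(2\omega t)\,y(t)$. The averages over the period $2\pi/\omega$ of $G$ and $\hat H$ are taken to be $G_{\rm av}=H\vartheta_{\rm av}$ and $\hat H_{\rm av}=H$. The subscript "av" denotes quantities of the averaged system, which is the system displayed in the claim. In the averaged system the oscillatory probing components are removed, so $s_{\rm av}=\Theta^*+\vartheta_{\rm av}$ and $T_{\rm av}(x,t)=T_m+u_{\rm av}(x,t)$. The last equation displayed in the claim is the averaged filtered control law written in state-space form with $U_{\rm av}(t)=-\partial_xu_{\rm av}(0,t)$. Compatibility of the initial data with the control law means that the boundary conditions hold at $t=0$: $u_{\rm av}(s_0,0)=0$ and $-\partial_xu_{\rm av}(0,0)=U_{\rm av}(0)$, where $U_{\rm av}(0)$ is the initial value of the filtered control. *)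

theory Defs
  imports "HOL-Analysis.Analysis"
begin

text \<open>
  A space-time function is written u x t, with x in the moving interval [0, s t] and t \<ge> 0.
  Values of u outside this region are irrelevant: every derivative below is taken within it
  (hence one-sided at the ends of the interval and at t = 0).
\<close>

definition moving_domain :: "(real \<Rightarrow> real) \<Rightarrow> (real \<times> real) set" where
  "moving_domain s = {(x, t). 0 \<le> t \<and> 0 \<le> x \<and> x \<le> s t}"

definition space_deriv :: "(real \<Rightarrow> real) \<Rightarrow> (real \<Rightarrow> real \<Rightarrow> real) \<Rightarrow> real \<Rightarrow> real \<Rightarrow> real" where
  "space_deriv s u x t = vector_derivative (\<lambda>y. u y t) (at x within {0..s t})"

definition H1_norm_sq :: "(real \<Rightarrow> real) \<Rightarrow> (real \<Rightarrow> real \<Rightarrow> real) \<Rightarrow> real \<Rightarrow> real" where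
  "H1_norm_sq s u t =
     integral {0..s t} (\<lambda>x. (u x t)\<^sup>2) + integral {0..s t} (\<lambda>x. (space_deriv s u x t)\<^sup>2)"

text \<open>
  Regularity of a classical solution: u and its first space derivative are continuous up to the
  whole boundary, the initial line included; the second space derivative is continuous up to the
  lateral boundaries for t > 0.
\<close>

definition classical_regularity :: "(real \<Rightarrow> real) \<Rightarrow> (real \<Rightarrow> real \<Rightarrow> real) \<Rightarrow> bool" where
  "classical_regularity s u \<longleftrightarrow>
     (\<forall>t\<ge>0. 0 < s t) \<and>
     (\<forall>t\<ge>0. (\<lambda>x. u x t) differentiable_on {0..s t}) \<and>
     (\<forall>t>0. (\<lambda>x. space_deriv s u x t) differentiable_on {0..s t}) \<and>
     continuous_on (moving_domain s) (\<lambda>(x, t). u x t) \<and>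
     continuous_on (moving_domain s) (\<lambda>(x, t). space_deriv s u x t) \<and>
     continuous_on (moving_domain s \<inter> {(x, t). 0 < t})
       (\<lambda>(x, t). space_deriv s (space_deriv s u) x t)"

definition s_av :: "real \<Rightarrow> (real \<Rightarrow> real) \<Rightarrow> real \<Rightarrow> real" where
  "s_av \<Theta>_star \<theta> t = \<Theta>_star + \<theta> t"

definition T_av :: "real \<Rightarrow> (real \<Rightarrow> real \<Rightarrow> real) \<Rightarrow> real \<Rightarrow> real \<Rightarrow> real" where
  "T_av Tm u x t = Tm + u x t"

definition average_closed_loop ::
  "real \<Rightarrow> real \<Rightarrow> real \<Rightarrow> real \<Rightarrow> (real \<Rightarrow> real) \<Rightarrow> (real \<Rightarrow> real \<Rightarrow> real) \<Rightarrow> bool" where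
  "average_closed_loop H K \<Theta>_star c \<theta> u \<longleftrightarrow>
     (let s = s_av \<Theta>_star \<theta> in
       classical_regularity s u \<and>
       (\<forall>t\<ge>0. (\<theta> has_real_derivative - space_deriv s u (s t) t) (at t within {0..})) \<and>
       (\<forall>t>0. \<forall>x\<in>{0<..<s t}.
          ((\<lambda>\<tau>. u x \<tau>) has_real_derivative space_deriv s (space_deriv s u) x t) (at t)) \<and>
       (\<forall>t>0. u (s t) t = 0) \<and>
       (\<forall>t\<ge>0. ((\<lambda>\<tau>. space_deriv s u 0 \<tau>) has_real_derivative
            - c * space_deriv s u 0 t + c * K * H * (\<theta> t + integral {0..s t} (\<lambda>x. u x t)))
          (at t within {0..})))"

text \<open>
  U is an output of the low-pass filter with transfer function c / (z + c), driven by
  -K (G + Hhat * integral of u) with the averages G = H * \<theta> and Hhat = H, where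
  \<theta> = s - \<Theta>_star.  The initial value of the filter state is arbitrary.
\<close>

definition filtered_control ::
  "real \<Rightarrow> real \<Rightarrow> real \<Rightarrow> (real \<Rightarrow> real) \<Rightarrow> (real \<Rightarrow> real) \<Rightarrow> (real \<Rightarrow> real \<Rightarrow> real) \<Rightarrow>
   (real \<Rightarrow> real) \<Rightarrow> bool" where
  "filtered_control H K c s \<theta> u U \<longleftrightarrow>
     (\<forall>t\<ge>0. (U has_real_derivative
        - c * U t + c * (- K * (H * \<theta> t + H * integral {0..s t} (\<lambda>x. u x t))))
       (at t within {0..}))"

definition compatible_initial_data ::
  "(real \<Rightarrow> real) \<Rightarrow> (real \<Rightarrow> real \<Rightarrow> real) \<Rightarrow> (real \<Rightarrow> real) \<Rightarrow> bool" where
  "compatible_initial_data s u U \<longleftrightarrow> u (s 0) 0 = 0 \<and> - space_deriv s u 0 0 = U 0"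

definition model_validity ::
  "real \<Rightarrow> real \<Rightarrow> (real \<Rightarrow> real) \<Rightarrow> (real \<Rightarrow> real \<Rightarrow> real) \<Rightarrow> bool" where
  "model_validity Tm s_star s u \<longleftrightarrow>
     (\<forall>t\<ge>0. \<forall>x\<in>{0<..<s t}. T_av Tm u x t > Tm) \<and>
     (\<forall>t\<ge>0. vector_derivative s (at t within {0..}) > 0) \<and>
     (\<forall>t>0. s 0 < s t \<and> s t < s_star) \<and> s 0 < s_star"

end

theory Submission
  imports Defs
begin

text \<open>
  Write \<open>v = u\<^sub>x\<close>, \<open>w = u\<^sub>x\<^sub>x\<close>, \<open>\<kappa> = K H > 0\<close>, \<open>S\<close> for the target position, and let
  \<open>U(t) = - v(0,t)\<close> be the heat flux entering at the fixed end.  Comments use the letters \<open>U\<close>,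
  \<open>E\<close>, \<open>J\<close>, \<open>V\<close>, \<open>Q\<close>, \<open>W\<close> for \<open>inflow\<close>, \<open>enthalpy\<close>, \<open>grad_energy\<close>, \<open>ode_form\<close>, \<open>grad_form\<close> and
  \<open>growing_mode\<close>.  Three observations give the theorem.

  \<^emph>\<open>The energy balance closes.\<close>  The enthalpy \<open>E = (s - S) + \<integral>u\<close> counts the heat spent on melting
  together with the heat stored in the liquid, so \<open>E' = U\<close>.  The filter equation is
  \<open>U' = - c U - c \<kappa> E\<close>.  The pair \<open>(E, U)\<close> therefore solves an autonomous, exponentially stable
  planar linear system, with a quadratic Lyapunov function \<open>V\<close> (\<open>ode_form_deriv\<close>).

  \<^emph>\<open>The gradient energy is dissipated.\<close>  Let \<open>J = \<integral>v\<^sup>2\<close>.  Since \<open>s' = - v(s)\<close> and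
  \<open>w(s) = v(s)\<^sup>2\<close>, the quantity \<open>Q = J - 2 U u(0)\<close> satisfies \<open>Q' = v(s)\<^sup>3 - 2 \<integral>w\<^sup>2 - 2 U' u(0)\<close>.
  The cubic term is negative because the interface advances, and \<open>\<integral>w\<^sup>2\<close> controls \<open>J\<close> up to \<open>U\<^sup>2\<close>
  by a Poincare inequality on an interval of length at most \<open>S\<close>.  Hence \<open>A V + Q\<close>, with \<open>A\<close>
  large, decays exponentially and is comparable to \<open>J + U\<^sup>2 + E\<^sup>2\<close> (\<open>lyapunov_decay\<close>). The latter
  dominates the squared \<open>H\<^sup>1\<close> norm and, through \<open>s - S = E - \<integral>u\<close>, the displacement.

  \<^emph>\<open>The initial flux is controlled by the initial state.\<close>  The bound so far contains \<open>U(0)\<^sup>2\<close>,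
  which the \<open>H\<^sup>1\<close> norm does not control for arbitrary data.  For solutions that stay in the
  physical regime forever it does.  The moment \<open>\<integral>cosh(x) u\<close> would by itself grow like \<open>exp t\<close>; a
  suitable linear combination \<open>W\<close> of it with \<open>E\<close> and \<open>U\<close> obeys \<open>W' = W - cosh(s) s'\<close>. As \<open>W\<close>
  stays bounded, \<open>W(0) = \<integral> exp(-t) cosh(s) s' dt\<close>, which lies between \<open>0\<close> and
  \<open>cosh(S) (S - s(0))\<close> because the total advance is at most \<open>S - s(0)\<close>.  Solving for \<open>U(0)\<close>
  bounds it by the displacement and the heat content (\<open>initial_input_sq_le\<close>).

  All time derivatives of spatial integrals are taken from the right and at positive times only.
  On \<open>[0, s(t)]\<close> the solution is defined at every later time, as the interval grows, so right
  difference quotients make sense up to the moving end; and a one-sided Gronwall inequality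
  suffices.
\<close>

section \<open>Monotonicity and growth from one-sided derivatives\<close>

text \<open>
  If \<open>f\<close> exceeded the line of slope \<open>\<epsilon>\<close> through some earlier point, then at the last time at
  which it does not exceed it the right derivative would have to be at least \<open>\<epsilon>\<close>.  The left end
  of the interval is reached by continuity, which is why derivatives are needed in the open
  interval only.
\<close>
lemma right_derivative_nonpos_imp_le:
  fixes f f' :: "real \<Rightarrow> real"
  assumes cont: "continuous_on {a..b} f" and "a \<le> b"
    and deriv: "\<And>t. a < t \<Longrightarrow> t < b \<Longrightarrow> (f has_real_derivative f' t) (at_right t)"
    and nonpos: "\<And>t. a < t \<Longrightarrow> t < b \<Longrightarrow> f' t \<le> 0"
  shows "f b \<le> f a"
proof -
  have later: "f b \<le> f c + \<epsilon> * (b - c)" if c: "a < c" "c < b" and "\<epsilon> > 0" for c \<epsilon>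
  proof (rule ccontr)
    assume contra: "\<not> ?thesis"
    define h where "h t = f t - f c - \<epsilon> * (t - c)" for t
    define Z where "Z = {t \<in> {c..b}. h t \<in> {..0}}"
    have "continuous_on {c..b} h"
      unfolding h_def using cont c by (auto intro!: continuous_intros elim: continuous_on_subset)
    then have "closed Z"
      unfolding Z_def
      using continuous_closed_preimage[of "{c..b}" h "{..0}"] by (simp add: vimage_def Int_def)
    moreover have "bounded Z"
      by (rule bounded_subset[of "{c..b}"]) (auto simp: Z_def)
    moreover have "c \<in> Z" using c by (simp add: Z_def h_def)
    ultimately obtain m where m: "m \<in> Z" "\<And>t. t \<in> Z \<Longrightarrow> t \<le> m"
      using compact_attains_sup[of Z] by (auto simp: compact_eq_bounded_closed)
    have "m < b" using m(1) contra by (cases "m = b") (auto simp: Z_def h_def)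
    have mc: "c \<le> m" "h m \<le> 0" using m(1) by (auto simp: Z_def)
    have "(h has_real_derivative f' m - \<epsilon>) (at_right m)"
      unfolding h_def using mc c \<open>m < b\<close>
      by (auto intro!: derivative_eq_intros deriv)
    moreover have "f' m - \<epsilon> < 0" using nonpos[of m] mc c \<open>m < b\<close> \<open>\<epsilon> > 0\<close> by auto
    ultimately obtain d where d: "d > 0" "\<And>k. k > 0 \<Longrightarrow> m + k \<in> {m<..} \<Longrightarrow> k < d \<Longrightarrow> h (m + k) < h m"
      using has_real_derivative_neg_dec_right[of h "f' m - \<epsilon>" m "{m<..}"] by blast
    define k where "k = min (d / 2) (b - m)"
    have k: "k > 0" "k < d" "m + k \<le> b" using d(1) \<open>m < b\<close> by (auto simp: k_def)
    have "m + k \<in> Z" using d(2)[of k] k mc by (auto simp: Z_def)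
    then show False using m(2)[of "m + k"] k by auto
  qed
  show ?thesis
  proof (cases "a = b")
    case False
    then have "a < b" using \<open>a \<le> b\<close> by simp
    have later': "f b \<le> f c" if c: "a < c" "c < b" for c
    proof (rule field_le_epsilon)
      fix e :: real assume "e > 0"
      show "f b \<le> f c + e"
        using later[OF c, of "e / (b - c)"] c \<open>e > 0\<close> by simp
    qed
    have "(f \<longlongrightarrow> f a) (at a within {a..b})"
      using cont \<open>a < b\<close> by (auto simp: continuous_on)
    then have "(f \<longlongrightarrow> f a) (at_right a)"
      using \<open>a < b\<close> by (simp add: at_within_Icc_at_right)
    moreover have "\<forall>\<^sub>F c in at_right a. f b \<le> f c"
      using later' \<open>a < b\<close> by (auto intro!: eventually_at_rightI[of a b])
    ultimately show ?thesis by (rule tendsto_lowerbound) simp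
  qed simp
qed

text \<open>The function \<open>f t * exp (- a * t)\<close> is nonincreasing.\<close>
lemma right_gronwall:
  fixes f f' :: "real \<Rightarrow> real"
  assumes cont: "continuous_on {0..} f"
    and deriv: "\<And>t. 0 < t \<Longrightarrow> (f has_real_derivative f' t) (at_right t)"
    and bound: "\<And>t. 0 < t \<Longrightarrow> f' t \<le> a * f t" and "0 \<le> t"
  shows "f t \<le> f 0 * exp (a * t)"
proof -
  have "f t * exp (- a * t) \<le> f 0 * exp (- a * 0)"
  proof (rule right_derivative_nonpos_imp_le[where f = "\<lambda>t. f t * exp (- a * t)"
        and f' = "\<lambda>t. (f' t - a * f t) * exp (- a * t)"])
    show "continuous_on {0..t} (\<lambda>t. f t * exp (- a * t))"
      by (intro continuous_intros continuous_on_subset[OF cont]) auto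
    show "((\<lambda>t. f t * exp (- a * t))
        has_real_derivative (f' t - a * f t) * exp (- a * t)) (at_right t)"
      if "0 < t" for t
      using that by (auto intro!: derivative_eq_intros deriv simp: algebra_simps)
    show "(f' t - a * f t) * exp (- a * t) \<le> 0" if "0 < t" for t
      using bound[OF that] by (intro mult_nonpos_nonneg) auto
  qed (fact \<open>0 \<le> t\<close>)
  then have "f t * exp (- a * t) * exp (a * t) \<le> f 0 * exp (a * t)"
    by (intro mult_right_mono) auto
  then show ?thesis by (simp add: mult.assoc flip: exp_add)
qed

lemma tendsto_integral_of_uniform_limit:
  fixes f :: "'a \<Rightarrow> real \<Rightarrow> real"
  assumes lim: "uniform_limit {a..b} f g F" and cont: "\<forall>\<^sub>F n in F. continuous_on {a..b} (f n)"
    and "F \<noteq> bot"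
  shows "((\<lambda>n. integral {a..b} (f n)) \<longlongrightarrow> integral {a..b} g) F"
proof -
  define h where "h n = (if continuous_on {a..b} (f n) then f n else (\<lambda>x. 0))" for n
  have eq: "\<forall>\<^sub>F n in F. h n = f n"
    using cont by eventually_elim (simp add: h_def)
  have "uniform_limit {a..b} h g F \<longleftrightarrow> uniform_limit {a..b} f g F"
    by (rule uniform_limit_cong) (use eq in \<open>auto elim!: eventually_mono\<close>)
  then have "uniform_limit {a..b} h g F" using lim by simp
  moreover have "continuous_on {a..b} (h n)" for n by (simp add: h_def)
  ultimately obtain I J where IJ: "\<And>n. (h n has_integral I n) {a..b}" "(g has_integral J) {a..b}"
      "(I \<longlongrightarrow> J) F"
    by (rule uniform_limit_integral[OF _ _ \<open>F \<noteq> bot\<close>]) blast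
  then have "((\<lambda>n. integral {a..b} (h n)) \<longlongrightarrow> integral {a..b} g) F"
    by (simp add: integral_unique[OF IJ(1)] integral_unique[OF IJ(2)])
  then show ?thesis
    by (rule Lim_transform_eventually) (use eq in eventually_elim, simp)
qed

text \<open>
  The Cauchy--Schwarz inequality behind both Poincare estimates; it comes from \<open>0 \<le> \<integral>(f' - m)\<^sup>2\<close>
  with \<open>m\<close> the mean slope between the two points.
\<close>
lemma increment_sq_le_integral_deriv_sq:
  fixes f f' :: "real \<Rightarrow> real"
  assumes "0 \<le> l" and deriv: "\<And>x. x \<in> {0..l} \<Longrightarrow> (f has_real_derivative f' x) (at x within {0..l})"
    and cont: "continuous_on {0..l} f'" and "x \<in> {0..l}" "y \<in> {0..l}"
  shows "(f x - f y)\<^sup>2 \<le> l * integral {0..l} (\<lambda>z. (f' z)\<^sup>2)"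
proof -
  have *: "(f b - f a)\<^sup>2 \<le> l * integral {0..l} (\<lambda>z. (f' z)\<^sup>2)" if ab: "0 \<le> a" "a < b" "b
      \<le> l" for a b
  proof -
    define m where "m = (f b - f a) / (b - a)"
    have sub: "{a..b} \<subseteq> {0..l}" using ab by auto
    have c: "continuous_on {a..b} f'" using cont sub by (rule continuous_on_subset)
    have I: "(f' has_integral (f b - f a)) {a..b}"
      using ab deriv
      by (intro fundamental_theorem_of_calculus)
        (auto simp flip: has_real_derivative_iff_has_vector_derivative intro!: DERIV_subset[OF _ sub])
    have I2: "((\<lambda>z. (f' z)\<^sup>2) has_integral integral {a..b} (\<lambda>z. (f' z)\<^sup>2)) {a..b}"
      by (intro integrable_integral integrable_continuous_interval continuous_intros c)
    have "((\<lambda>z. ((f' z)\<^sup>2 - (2 * m) * f' z) + m\<^sup>2) has_integral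
        (integral {a..b} (\<lambda>z. (f' z)\<^sup>2) - (2 * m) * (f b - f a)) + m\<^sup>2 * (b - a)) {a..b}"
      using has_integral_const_real[of "m\<^sup>2" a b] ab
      by (intro has_integral_add has_integral_diff has_integral_mult_right I I2)
          (simp add: mult.commute)
    then have "0 \<le> (integral {a..b} (\<lambda>z. (f' z)\<^sup>2) - (2 * m) * (f b - f a)) + m\<^sup>2 * (b - a)"
    proof (rule has_integral_nonneg)
      fix z
      have "(f' z)\<^sup>2 - (2 * m) * f' z + m\<^sup>2 = (f' z - m)\<^sup>2"
        by (simp add: power2_eq_square algebra_simps)
      then show "0 \<le> (f' z)\<^sup>2 - (2 * m) * f' z + m\<^sup>2" by simp
    qed
    also have "\<dots> = integral {a..b} (\<lambda>z. (f' z)\<^sup>2) - (f b - f a)\<^sup>2 / (b - a)"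
    proof -
      have "f b - f a = m * (b - a)" using ab by (simp add: m_def)
      then show ?thesis using ab by (simp add: power2_eq_square)
    qed
    finally have "(f b - f a)\<^sup>2 \<le> (b - a) * integral {a..b} (\<lambda>z. (f' z)\<^sup>2)"
      using ab by (simp add: field_simps)
    also have "\<dots> \<le> l * integral {0..l} (\<lambda>z. (f' z)\<^sup>2)"
      using ab sub
      by (intro mult_mono integral_subset_le integral_nonneg integrable_continuous_interval
          continuous_intros c cont) auto
    finally show ?thesis .
  qed
  have "0 \<le> integral {0..l} (\<lambda>z. (f' z)\<^sup>2)"
    by (intro integral_nonneg integrable_continuous_interval continuous_intros cont) auto
  then show ?thesis
    using *[of x y] *[of y x] assms(1,4,5)
    by (cases x y rule: linorder_cases) (auto simp: power2_commute)
qed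

section \<open>Heat flow on an expanding interval\<close>

lemma continuous_on_slice:
  assumes "continuous_on A (\<lambda>(x, t). f x t)" "\<And>x. x \<in> S \<Longrightarrow> (x, t) \<in> A"
  shows "continuous_on S (\<lambda>x. f x t)"
proof -
  have "continuous_on S (\<lambda>x. case (x, t) of (x, t) \<Rightarrow> f x t)"
    by (rule continuous_on_compose2[OF assms(1)]) (auto intro!: continuous_intros assms(2))
  then show ?thesis by simp
qed

text \<open>
  The one-phase Stefan problem with a strictly advancing interface; the condition at the fixed
  end is left open.  The functions \<open>v\<close> and \<open>w\<close> stand for the first and second space derivatives
  of \<open>u\<close>.
\<close>
locale expanding_heat_flow =
  fixes s :: "real \<Rightarrow> real" and u v w :: "real \<Rightarrow> real \<Rightarrow> real"
  assumes s_pos: "0 \<le> t \<Longrightarrow> 0 < s t"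
    and s_deriv: "0 \<le> t \<Longrightarrow> (s has_real_derivative - v (s t) t) (at t within {0..})"
    and outflow: "0 \<le> t \<Longrightarrow> v (s t) t < 0"
    and u_x: "0 \<le> t \<Longrightarrow> x \<in> {0..s t} \<Longrightarrow>
      ((\<lambda>y. u y t) has_real_derivative v x t) (at x within {0..s t})"
    and v_x: "0 < t \<Longrightarrow> x \<in> {0..s t} \<Longrightarrow>
      ((\<lambda>y. v y t) has_real_derivative w x t) (at x within {0..s t})"
    and cont_u: "continuous_on (moving_domain s) (\<lambda>(x, t). u x t)"
    and cont_v: "continuous_on (moving_domain s) (\<lambda>(x, t). v x t)"
    and cont_w: "continuous_on (moving_domain s \<inter> {(x, t). 0 < t}) (\<lambda>(x, t). w x t)"
    and heat: "0 < t \<Longrightarrow> x \<in> {0<..<s t} \<Longrightarrow> (u x has_real_derivative w x t) (at t)"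
    and dirichlet: "0 \<le> t \<Longrightarrow> u (s t) t = 0"
begin

lemma s_mono:
  assumes "0 \<le> t" "t \<le> \<tau>"
  shows "s t \<le> s \<tau>"
proof -
  have "\<exists>y. (s has_real_derivative y) (at x) \<and> 0 \<le> y" if "t < x" "x < \<tau>" for x
  proof (intro exI conjI)
    have "at x within {0..} = at x" using that assms by (intro at_within_interior) auto
    then show "(s has_real_derivative - v (s x) x) (at x)" using s_deriv[of x] that assms by auto
    show "0 \<le> - v (s x) x" using outflow[of x] that assms by auto
  qed
  moreover have "continuous_on {t..\<tau>} s"
    using assms
    by (intro continuous_on_subset[OF DERIV_continuous_on[of "{0..}" s "\<lambda>t. - v (s t) t"]])
      (auto intro: s_deriv)
  ultimately show ?thesis by (intro DERIV_nonneg_imp_increasing_open[OF assms(2)]) auto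
qed

lemma s_right_derivative: "0 \<le> t \<Longrightarrow> (s has_real_derivative - v (s t) t) (at_right t)"
  by (rule DERIV_subset[OF s_deriv]) auto

lemma continuous_on_s: "continuous_on {0..} s"
  by (rule DERIV_continuous_on[of "{0..}" s "\<lambda>t. - v (s t) t"]) (auto intro: s_deriv)

abbreviation interior_times :: "(real \<times> real) set" where
  "interior_times \<equiv> moving_domain s \<inter> {(x, t). 0 < t}"

lemma cont_u': "continuous_on interior_times (\<lambda>(x, t). u x t)"
  by (rule continuous_on_subset[OF cont_u]) auto

lemma cont_v': "continuous_on interior_times (\<lambda>(x, t). v x t)"
  by (rule continuous_on_subset[OF cont_v]) auto

lemma slice_in_domain: "0 < t \<Longrightarrow> t \<le> \<tau> \<Longrightarrow> x \<in> {0..s t} \<Longrightarrow> (x, \<tau>) \<in> interior_times"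
  using s_mono[of t \<tau>] by (auto simp: moving_domain_def)

lemma continuous_slice:
  assumes "continuous_on interior_times (\<lambda>(x, t). f x t)" "0 < t" "t \<le> \<tau>"
  shows "continuous_on {0..s t} (\<lambda>x. f x \<tau>)"
  using slice_in_domain assms by (intro continuous_on_slice[OF assms(1)]) auto

text \<open>Heine--Cantor on the rectangle \<open>[0, s t] \<times> [t, t + 1]\<close>, which lies in the moving domain.\<close>
lemma uniform_limit_slices:
  assumes cont: "continuous_on interior_times (\<lambda>(x, t). f x t)" and t: "0 < t"
  shows "uniform_limit {0..s t} (\<lambda>\<tau> x. f x \<tau>) (\<lambda>x. f x t) (at_right t)"
proof (rule uniform_limitI)
  fix e :: real assume "e > 0"
  let ?R = "{0..s t} \<times> {t..t + 1}"
  have "continuous_on ?R (\<lambda>(x, t). f x t)"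
    using slice_in_domain t by (intro continuous_on_subset[OF cont]) auto
  then have "uniformly_continuous_on ?R (\<lambda>(x, t). f x t)"
    by (rule compact_uniformly_continuous) (intro compact_Times compact_Icc)
  then obtain d where d: "d > 0" "\<And>p q. p \<in> ?R \<Longrightarrow> q \<in> ?R \<Longrightarrow> dist q p < d \<Longrightarrow>
      dist (case q of (x, t) \<Rightarrow> f x t) (case p of (x, t) \<Rightarrow> f x t) < e"
    unfolding uniformly_continuous_on_def using \<open>e > 0\<close> by metis
  show "\<forall>\<^sub>F \<tau> in at_right t. \<forall>x\<in>{0..s t}. dist (f x \<tau>) (f x t) < e"
  proof (rule eventually_at_rightI[of t "t + min d 1"])
    fix \<tau> assume \<tau>: "\<tau> \<in> {t<..<t + min d 1}"
    show "\<forall>x\<in>{0..s t}. dist (f x \<tau>) (f x t) < e"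
    proof
      fix x assume "x \<in> {0..s t}"
      then show "dist (f x \<tau>) (f x t) < e"
        using d(2)[of "(x, t)" "(x, \<tau>)"] \<tau> by (auto simp: dist_Pair_Pair dist_real_def)
    qed
  qed (use d(1) in auto)
qed

text \<open>
  The heat equation holds at interior points only.  There the mean value theorem turns the
  quotient into a value of \<open>w\<close> at an intermediate time; the resulting uniform bound extends to
  the two end points by continuity.  Thus \<open>u\<close> has the right time derivative \<open>w\<close> on the whole
  closed interval.
\<close>
lemma uniform_limit_time_quotient:
  assumes t: "0 < t"
  shows "uniform_limit {0..s t} (\<lambda>\<tau> x. (u x \<tau> - u x t) / (\<tau> - t)) (\<lambda>x. w x t) (at_right t)"
proof (rule uniform_limitI)
  fix e :: real assume "e > 0"
  then have "\<forall>\<^sub>F \<tau> in at_right t. \<forall>x\<in>{0..s t}. dist (w x \<tau>) (w x t) < e / 2"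
    using uniform_limitD[OF uniform_limit_slices[OF cont_w t], of "e / 2"] by simp
  then obtain b where b: "b > t"
    "\<And>\<tau> x. t < \<tau> \<Longrightarrow> \<tau> < b \<Longrightarrow> x \<in> {0..s t} \<Longrightarrow> dist (w x \<tau>) (w x t) < e / 2"
    unfolding eventually_at_right_field by blast
  show "\<forall>\<^sub>F \<tau> in at_right t. \<forall>x\<in>{0..s t}. dist ((u x \<tau> - u x t) / (\<tau> - t)) (w x t) < e"
  proof (rule eventually_at_rightI[of t b])
    fix \<tau> assume \<tau>: "\<tau> \<in> {t<..<b}"
    let ?q = "\<lambda>x. (u x \<tau> - u x t) / (\<tau> - t) - w x t"
    have interior: "norm (?q x) \<le> e / 2" if x: "x \<in> {0<..<s t}" for x
    proof -
      have "(u x has_real_derivative w x \<sigma>) (at \<sigma>)" if "t \<le> \<sigma>" for \<sigma>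
        using heat[of \<sigma> x] that t x s_mono[of t \<sigma>] by auto
      then obtain z where z: "t < z" "z < \<tau>" "u x \<tau> - u x t = (\<tau> - t) * w x z"
        using MVT2[of t \<tau> "u x" "w x"] \<tau> by auto
      then show ?thesis
        using b(2)[of z x] x \<tau> by (simp add: dist_real_def)
    qed
    have cl: "closure {0<..<s t} = {0..s t}"
      using s_pos[of t] t by (intro closure_greaterThanLessThan) simp
    have "continuous_on {0..s t} ?q"
      using t \<tau>
      by (intro continuous_intros continuous_slice[OF cont_u'] continuous_slice[OF cont_w]) auto
    then have "norm (?q x) \<le> e / 2" if "x \<in> {0..s t}" for x
      using continuous_on_closure_norm_le[of "{0<..<s t}" ?q "e / 2" x] interior that
      unfolding cl by blast
    then show "\<forall>x\<in>{0..s t}. dist ((u x \<tau> - u x t) / (\<tau> - t)) (w x t) < e"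
      using \<open>e > 0\<close> by (fastforce simp: dist_real_def)
  qed (fact b(1))
qed

text \<open>
  The contribution of the strip swept by the interface to the derivative of a moving integral, by
  the mean value theorem for integrals and the Stefan condition.
\<close>
lemma boundary_layer_limit:
  assumes cont: "continuous_on interior_times (\<lambda>(x, t). f x t)" and t: "0 < t"
  shows "((\<lambda>\<tau>. integral {s t..s \<tau>} (\<lambda>x. f x \<tau>) / (\<tau> - t)) \<longlongrightarrow> f (s t) t * - v (s t) t)
    (at_right t)"
proof -
  have "\<exists>\<xi>\<in>{s t..s \<tau>}. integral {s t..s \<tau>} (\<lambda>x. f x \<tau>) = f \<xi> \<tau> * (s \<tau> - s t)" if "t < \<tau>" for \<tau>
  proof (cases "s t = s \<tau>")
    case False
    then have lt: "s t < s \<tau>" using s_mono[of t \<tau>] t that by auto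
    have c: "continuous_on {s t..s \<tau>} (\<lambda>x. f x \<tau>)"
      using continuous_slice[OF cont, of \<tau> \<tau>] t that s_pos[of t]
      by (auto elim!: continuous_on_subset)
    let ?F = "\<lambda>x. integral {s t..x} (\<lambda>x. f x \<tau>)"
    have F: "(?F has_real_derivative f x \<tau>) (at x within {s t..s \<tau>})" if "x \<in> {s t..s \<tau>}" for x
      using integral_has_real_derivative[OF c that] .
    have "continuous_on {s t..s \<tau>} ?F" by (rule DERIV_continuous_on[OF F])
    moreover have "(?F has_derivative (*) (f x \<tau>)) (at x)" if "s t < x" "x < s \<tau>" for x
      using F[of x] that by (simp add: at_within_Icc_at has_field_derivative_def)
    ultimately obtain z where z: "s t < z" "z < s \<tau>" "?F (s \<tau>) - ?F (s t) = f z \<tau> * (s \<tau> - s t)"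
      by (rule mvt[OF lt, of ?F "\<lambda>x. (*) (f x \<tau>)"])
    then have "integral {s t..s \<tau>} (\<lambda>x. f x \<tau>) = f z \<tau> * (s \<tau> - s t)" by simp
    then show ?thesis using z(1,2) by (intro bexI[of _ z]) auto
  qed auto
  then have "\<forall>\<tau>. \<exists>\<xi>. t < \<tau> \<longrightarrow>
      \<xi> \<in> {s t..s \<tau>} \<and> integral {s t..s \<tau>} (\<lambda>x. f x \<tau>) = f \<xi> \<tau> * (s \<tau> - s t)"
    by blast
  from choice[OF this] obtain \<xi> where \<xi>: "\<And>\<tau>. t < \<tau> \<Longrightarrow> \<xi> \<tau> \<in> {s t..s \<tau>}"
      "\<And>\<tau>. t < \<tau> \<Longrightarrow> integral {s t..s \<tau>} (\<lambda>x. f x \<tau>) = f (\<xi> \<tau>) \<tau> * (s \<tau> - s t)"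
    by blast
  have ev: "\<forall>\<^sub>F \<tau> in at_right t. t < \<tau>" by (simp add: eventually_at_right_less)
  have s_lim: "(s \<longlongrightarrow> s t) (at_right t)"
    using DERIV_continuous[OF s_right_derivative[of t]] t by (simp add: continuous_within)
  have "(\<xi> \<longlongrightarrow> s t) (at_right t)"
    by (rule tendsto_sandwich[OF _ _ tendsto_const s_lim])
      (use ev \<xi>(1) in \<open>auto elim!: eventually_mono\<close>)
  then have "((\<lambda>\<tau>. (\<xi> \<tau>, \<tau>)) \<longlongrightarrow> (s t, t)) (at_right t)"
    by (intro tendsto_intros)
  then have "((\<lambda>\<tau>. case (\<xi> \<tau>, \<tau>) of (x, t) \<Rightarrow> f x t) \<longlongrightarrow> (case (s t, t) of (x, t) \<Rightarrow> f x t)) (at_right t)"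
  proof (rule continuous_on_tendsto_compose[OF cont])
    show "(s t, t) \<in> interior_times"
      using t s_pos[of t] by (auto simp: moving_domain_def)
    show "\<forall>\<^sub>F \<tau> in at_right t. (\<xi> \<tau>, \<tau>) \<in> interior_times"
      using ev
    proof eventually_elim
      case (elim \<tau>)
      then show ?case using t s_pos[of t] \<xi>(1)[of \<tau>] by (auto simp: moving_domain_def)
    qed
  qed
  moreover have "((\<lambda>\<tau>. (s \<tau> - s t) / (\<tau> - t)) \<longlongrightarrow> - v (s t) t) (at_right t)"
    using s_right_derivative[of t] t by (simp add: has_field_derivative_iff)
  ultimately have "((\<lambda>\<tau>. f (\<xi> \<tau>) \<tau> * ((s \<tau> - s t) / (\<tau> - t))) \<longlongrightarrow> f (s t) t * - v (s t) t) (at_right t)"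
    unfolding prod.case by (rule tendsto_mult)
  then show ?thesis
    by (rule Lim_transform_eventually) (use ev \<xi>(2) in \<open>auto elim!: eventually_mono\<close>)
qed

text \<open>
  Leibniz' rule.  The interior part is a hypothesis on the integrated quotient, not on a
  pointwise time derivative, because for \<open>f = v\<^sup>2\<close> the latter need not exist.
\<close>
lemma moving_integral_right_derivative:
  assumes cont: "continuous_on interior_times (\<lambda>(x, t). f x t)" and t: "0 < t"
    and lim: "((\<lambda>\<tau>. integral {0..s t} (\<lambda>x. (f x \<tau> - f x t) / (\<tau> - t))) \<longlongrightarrow> G) (at_right t)"
  shows "((\<lambda>\<tau>. integral {0..s \<tau>} (\<lambda>x. f x \<tau>)) has_real_derivative G + f (s t) t * - v (s t) t)
    (at_right t)"
  unfolding has_field_derivative_iff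
proof (rule Lim_transform_eventually)
  show "((\<lambda>\<tau>. integral {0..s t} (\<lambda>x. (f x \<tau> - f x t) / (\<tau> - t))
      + integral {s t..s \<tau>} (\<lambda>x. f x \<tau>) / (\<tau> - t)) \<longlongrightarrow> G + f (s t) t * - v (s t) t) (at_right t)"
    by (intro tendsto_add lim boundary_layer_limit cont t)
  show "\<forall>\<^sub>F \<tau> in at_right t. integral {0..s t} (\<lambda>x. (f x \<tau> - f x t) / (\<tau> - t))
      + integral {s t..s \<tau>} (\<lambda>x. f x \<tau>) / (\<tau> - t)
      = (integral {0..s \<tau>} (\<lambda>x. f x \<tau>) - integral {0..s t} (\<lambda>x. f x t)) / (\<tau> - t)"
    using eventually_at_right_less
  proof eventually_elim
    case (elim \<tau>)
    have "integral {0..s \<tau>} (\<lambda>x. f x \<tau>) =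
        integral {0..s t} (\<lambda>x. f x \<tau>) + integral {s t..s \<tau>} (\<lambda>x. f x \<tau>)"
      using s_mono[of t \<tau>] s_pos[of t] t elim continuous_slice[OF cont, of \<tau> \<tau>]
      by (intro Henstock_Kurzweil_Integration.integral_combine[symmetric]
        integrable_continuous_interval) auto
    moreover have "integral {0..s t} (\<lambda>x. (f x \<tau> - f x t) / (\<tau> - t)) =
        (integral {0..s t} (\<lambda>x. f x \<tau>) - integral {0..s t} (\<lambda>x. f x t)) / (\<tau> - t)"
      using t elim
      by (simp add: integral_diff integrable_continuous_interval continuous_slice[OF cont])
    ultimately show ?case by (simp add: add_divide_distrib diff_divide_distrib)
  qed
qed

text \<open>
  Green's formula against an eigenfunction \<open>\<phi>'' = k \<phi>\<close> that is flat at the fixed end.  Flatness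
  removes the unknown boundary value \<open>u 0 t\<close>, so that only the two fluxes and the moment itself
  remain.
\<close>
lemma moment_right_derivative:
  assumes t: "0 < t"
    and \<phi>: "\<And>x. (\<phi> has_real_derivative \<phi>' x) (at x)"
    and \<phi>': "\<And>x. (\<phi>' has_real_derivative k * \<phi> x) (at x)" "\<phi>' 0 = 0"
  shows "((\<lambda>\<tau>. integral {0..s \<tau>} (\<lambda>x. \<phi> x * u x \<tau>)) has_real_derivative
    k * integral {0..s t} (\<lambda>x. \<phi> x * u x t) + \<phi> (s t) * v (s t) t - \<phi> 0 * v 0 t) (at_right t)"
proof -
  have c\<phi>: "continuous_on A \<phi>" for A
    using \<phi> by (intro DERIV_continuous_on) (auto intro: DERIV_subset)
  have c\<phi>': "continuous_on A (\<lambda>(x, t :: real). \<phi> x)" for A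
    unfolding case_prod_beta
      by (intro continuous_on_compose2[OF c\<phi>[of UNIV]] continuous_intros) auto
  have "continuous_on interior_times (\<lambda>z. (case z of (x, t) \<Rightarrow> \<phi> x) * (case z of (x, t) \<Rightarrow> u x t))"
    by (intro continuous_intros c\<phi>' cont_u')
  then have cont: "continuous_on interior_times (\<lambda>(x, t). \<phi> x * u x t)"
    by (simp add: case_prod_beta)
  note slices = continuous_slice[OF cont_u', of t] continuous_slice[OF cont_v', of t]
    continuous_slice[OF cont_w, of t]
  have ev: "\<forall>\<^sub>F \<tau> in at_right t. t < \<tau>" by (simp add: eventually_at_right_less)
  have "uniform_limit {0..s t} (\<lambda>\<tau> x. \<phi> x * ((u x \<tau> - u x t) / (\<tau> - t))) (\<lambda>x. \<phi> x * w x t) (at_right t)"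
    using t
    by (intro uniform_lim_mult uniform_limit_const uniform_limit_time_quotient
        compact_imp_bounded compact_continuous_image c\<phi> slices) auto
  then have "((\<lambda>\<tau>. integral {0..s t} (\<lambda>x. \<phi> x * ((u x \<tau> - u x t) / (\<tau> - t)))) \<longlongrightarrow>
      integral {0..s t} (\<lambda>x. \<phi> x * w x t)) (at_right t)"
  proof (rule tendsto_integral_of_uniform_limit)
    show "\<forall>\<^sub>F \<tau> in at_right t. continuous_on {0..s t} (\<lambda>x. \<phi> x * ((u x \<tau> - u x t) / (\<tau> - t)))"
      using ev by eventually_elim (use t in \<open>intro continuous_intros c\<phi> slices; simp\<close>)
  qed simp
  then have "((\<lambda>\<tau>. integral {0..s t} (\<lambda>x. (\<phi> x * u x \<tau> - \<phi> x * u x t) / (\<tau> - t))) \<longlongrightarrow>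
      integral {0..s t} (\<lambda>x. \<phi> x * w x t)) (at_right t)"
    by (simp add: algebra_simps)
  from moving_integral_right_derivative[OF cont t this]
  have deriv: "((\<lambda>\<tau>. integral {0..s \<tau>} (\<lambda>x. \<phi> x * u x \<tau>)) has_real_derivative
      integral {0..s t} (\<lambda>x. \<phi> x * w x t)) (at_right t)"
    using dirichlet[of t] t by simp
  have "((\<lambda>x. \<phi> x * w x t - k * (\<phi> x * u x t)) has_integral
      (\<phi> (s t) * v (s t) t - \<phi>' (s t) * u (s t) t) - (\<phi> 0 * v 0 t - \<phi>' 0 * u 0 t)) {0..s t}"
    using s_pos[of t] t
    by (intro fundamental_theorem_of_calculus)
      (auto simp flip: has_real_derivative_iff_has_vector_derivative simp: algebra_simps
        intro!: derivative_eq_intros u_x v_x DERIV_subset[OF \<phi>] DERIV_subset[OF \<phi>'(1)])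
  then have "integral {0..s t} (\<lambda>x. \<phi> x * w x t - k * (\<phi> x * u x t)) =
      \<phi> (s t) * v (s t) t - \<phi> 0 * v 0 t"
    using dirichlet[of t] \<phi>'(2) t by (simp add: integral_unique)
  moreover have "integral {0..s t} (\<lambda>x. \<phi> x * w x t - k * (\<phi> x * u x t)) =
      integral {0..s t} (\<lambda>x. \<phi> x * w x t) - k * integral {0..s t} (\<lambda>x. \<phi> x * u x t)"
    using t
    by (subst integral_diff)
      (auto intro!: integrable_continuous_interval continuous_intros c\<phi> slices)
  ultimately have "integral {0..s t} (\<lambda>x. \<phi> x * w x t) =
      k * integral {0..s t} (\<lambda>x. \<phi> x * u x t) + \<phi> (s t) * v (s t) t - \<phi> 0 * v 0 t"
    by linarith
  then show ?thesis using deriv by (simp only:)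
qed

text \<open>
  Differentiating \<open>u (s t) t = 0\<close> along the interface gives \<open>u\<^sub>t = - v s' = v\<^sup>2\<close> there.
\<close>
lemma w_at_interface:
  assumes t: "0 < t"
  shows "w (s t) t = (v (s t) t)\<^sup>2"
proof -
  have "((\<lambda>\<tau>. (u (s t) \<tau> - u (s t) t) / (\<tau> - t)) \<longlongrightarrow> w (s t) t) (at_right t)"
    using tendsto_uniform_limitI[OF uniform_limit_time_quotient[OF t], of "s t"] s_pos[of t] t by simp
  moreover have "((\<lambda>\<tau>. (u (s t) \<tau> - u (s t) t) / (\<tau> - t)) \<longlongrightarrow> (v (s t) t)\<^sup>2) (at_right t)"
  proof (rule Lim_transform_eventually)
    show "((\<lambda>\<tau>. - (integral {s t..s \<tau>} (\<lambda>x. v x \<tau>) / (\<tau> - t))) \<longlongrightarrow> (v (s t) t)\<^sup>2) (at_right t)"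
      using tendsto_minus[OF boundary_layer_limit[OF cont_v' t]] by (simp add: power2_eq_square)
    show "\<forall>\<^sub>F \<tau> in at_right t. - (integral {s t..s \<tau>} (\<lambda>x. v x \<tau>) / (\<tau> - t))
        = (u (s t) \<tau> - u (s t) t) / (\<tau> - t)"
      using eventually_at_right_less
    proof eventually_elim
      case (elim \<tau>)
      have "((\<lambda>x. v x \<tau>) has_integral u (s \<tau>) \<tau> - u (s t) \<tau>) {s t..s \<tau>}"
        using t elim s_mono[of t \<tau>] s_pos[of t]
        by (intro fundamental_theorem_of_calculus)
          (auto simp flip: has_real_derivative_iff_has_vector_derivative intro!: DERIV_subset[OF u_x])
      then show ?case
        using dirichlet[of t] dirichlet[of \<tau>] t elim by (simp add: integral_unique field_simps)
    qed
  qed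
  ultimately show ?thesis by (rule tendsto_unique[rotated]) simp
qed

text \<open>
  Formally \<open>\<integral>2 v v\<^sub>t\<close> is integrated by parts into \<open>[2 v u\<^sub>t] - 2 \<integral>w u\<^sub>t\<close>.  Since a mixed
  derivative \<open>v\<^sub>t\<close> need not exist, the integration by parts is done on the difference quotient:
  with \<open>q\<close> the quotient of \<open>u\<close>, that of \<open>v\<^sup>2\<close> equals \<open>q\<^sub>x (v \<tau> + v t)\<close>, and after moving the
  space derivative off \<open>q\<close> only quantities that converge uniformly are left.  At the interface
  the terms \<open>2 w v = 2 v\<^sup>3\<close> and \<open>s' v\<^sup>2 = - v\<^sup>3\<close> combine to \<open>v\<^sup>3\<close>.
\<close>
lemma dirichlet_energy_right_derivative:
  assumes t: "0 < t"
  shows "((\<lambda>\<tau>. integral {0..s \<tau>} (\<lambda>x. (v x \<tau>)\<^sup>2)) has_real_derivative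
    (v (s t) t) ^ 3 - 2 * w 0 t * v 0 t - 2 * integral {0..s t} (\<lambda>x. (w x t)\<^sup>2)) (at_right t)"
proof -
  have "continuous_on interior_times (\<lambda>z. (case z of (x, t) \<Rightarrow> v x t)\<^sup>2)"
    by (intro continuous_intros cont_v')
  then have cont: "continuous_on interior_times (\<lambda>(x, t). (v x t)\<^sup>2)"
    by (simp add: case_prod_beta)
  let ?q = "\<lambda>\<tau> x. (u x \<tau> - u x t) / (\<tau> - t)"
  have slices: "continuous_on {0..s t} (\<lambda>x. u x \<tau>)" "continuous_on {0..s t} (\<lambda>x. v x \<tau>)"
    "continuous_on {0..s t} (\<lambda>x. w x \<tau>)" if "t \<le> \<tau>" for \<tau>
    using continuous_slice[OF cont_u' t that] continuous_slice[OF cont_v' t that]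
      continuous_slice[OF cont_w t that] by auto
  have ev: "\<forall>\<^sub>F \<tau> in at_right t. t < \<tau>" by (simp add: eventually_at_right_less)
  have at_x: "((\<lambda>\<tau>. ?q \<tau> x) \<longlongrightarrow> w x t) (at_right t)" "((\<lambda>\<tau>. v x \<tau>) \<longlongrightarrow> v x t) (at_right t)"
    if "x \<in> {0..s t}" for x
    using tendsto_uniform_limitI[OF uniform_limit_time_quotient[OF t] that]
      tendsto_uniform_limitI[OF uniform_limit_slices[OF cont_v' t] that] by auto
  have "uniform_limit {0..s t} (\<lambda>\<tau> x. ?q \<tau> x * (w x \<tau> + w x t)) (\<lambda>x. w x t * (w x t
      + w x t)) (at_right t)"
    by (intro uniform_lim_mult uniform_limit_add uniform_limit_const uniform_limit_time_quotient
        uniform_limit_slices cont_w t compact_imp_bounded compact_continuous_image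
        continuous_intros slices order_refl compact_Icc)
  then have *: "((\<lambda>\<tau>. integral {0..s t} (\<lambda>x. ?q \<tau> x * (w x \<tau> + w x t))) \<longlongrightarrow>
      integral {0..s t} (\<lambda>x. w x t * (w x t + w x t))) (at_right t)"
  proof (rule tendsto_integral_of_uniform_limit)
    show "\<forall>\<^sub>F \<tau> in at_right t. continuous_on {0..s t} (\<lambda>x. ?q \<tau> x * (w x \<tau> + w x t))"
      using ev by eventually_elim (intro continuous_intros slices; simp)
  qed simp
  have lim_int: "((\<lambda>\<tau>. integral {0..s t} (\<lambda>x. ?q \<tau> x * (w x \<tau> + w x t))) \<longlongrightarrow>
      2 * integral {0..s t} (\<lambda>x. (w x t)\<^sup>2)) (at_right t)"
  proof -
    have "integral {0..s t} (\<lambda>x. w x t * (w x t + w x t)) = integral {0..s t} (\<lambda>x. 2 * (w x t)\<^sup>2)"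
      by (rule integral_cong) (simp add: power2_eq_square)
    then show ?thesis using * by (simp only: integral_mult_right)
  qed
  have lim: "((\<lambda>\<tau>. ?q \<tau> (s t) * (v (s t) \<tau> + v (s t) t) - ?q \<tau> 0 * (v 0 \<tau> + v 0 t)
      - integral {0..s t} (\<lambda>x. ?q \<tau> x * (w x \<tau> + w x t))) \<longlongrightarrow>
      w (s t) t * (v (s t) t + v (s t) t) - w 0 t * (v 0 t + v 0 t)
      - 2 * integral {0..s t} (\<lambda>x. (w x t)\<^sup>2)) (at_right t)"
    by (intro tendsto_diff tendsto_mult tendsto_add tendsto_const at_x lim_int)
      (use s_pos[of t] t in auto)
  have "((\<lambda>\<tau>. integral {0..s t} (\<lambda>x. ((v x \<tau>)\<^sup>2 - (v x t)\<^sup>2) / (\<tau> - t))) \<longlongrightarrow>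
      w (s t) t * (v (s t) t + v (s t) t) - w 0 t * (v 0 t + v 0 t)
      - 2 * integral {0..s t} (\<lambda>x. (w x t)\<^sup>2)) (at_right t)"
    using lim
  proof (rule Lim_transform_eventually)
    show "\<forall>\<^sub>F \<tau> in at_right t. ?q \<tau> (s t) * (v (s t) \<tau> + v (s t) t) - ?q \<tau> 0 * (v 0 \<tau> + v 0 t)
        - integral {0..s t} (\<lambda>x. ?q \<tau> x * (w x \<tau> + w x t))
        = integral {0..s t} (\<lambda>x. ((v x \<tau>)\<^sup>2 - (v x t)\<^sup>2) / (\<tau> - t))"
      using ev
    proof eventually_elim
      case (elim \<tau>)
      have sub: "{0..s t} \<subseteq> {0..s \<tau>}" using s_mono[of t \<tau>] t elim by auto
      have "((\<lambda>x. ((v x \<tau>)\<^sup>2 - (v x t)\<^sup>2) / (\<tau> - t) + ?q \<tau> x * (w x \<tau> + w x t)) has_integral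
          ?q \<tau> (s t) * (v (s t) \<tau> + v (s t) t) - ?q \<tau> 0 * (v 0 \<tau> + v 0 t)) {0..s t}"
      proof (rule fundamental_theorem_of_calculus)
        fix x assume x: "x \<in> {0..s t}"
        then have x': "x \<in> {0..s \<tau>}" using sub by auto
        have "((\<lambda>x. u x \<tau>) has_real_derivative v x \<tau>) (at x within {0..s t})"
          "((\<lambda>x. v x \<tau>) has_real_derivative w x \<tau>) (at x within {0..s t})"
          using DERIV_subset[OF u_x[OF _ x'] sub] DERIV_subset[OF v_x[OF _ x'] sub] t elim by auto
        moreover have "((\<lambda>x. u x t) has_real_derivative v x t) (at x within {0..s t})"
          "((\<lambda>x. v x t) has_real_derivative w x t) (at x within {0..s t})"
          using u_x[OF _ x] v_x[OF _ x] t by auto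
        ultimately have "((\<lambda>x. ?q \<tau> x * (v x \<tau> + v x t)) has_real_derivative
            (v x \<tau> - v x t) / (\<tau> - t) * (v x \<tau> + v x t) + (w x \<tau> + w x t) * ?q \<tau> x)
            (at x within {0..s t})"
          by (intro DERIV_mult DERIV_add DERIV_diff DERIV_cdivide)
        then show "((\<lambda>x. ?q \<tau> x * (v x \<tau> + v x t)) has_vector_derivative
            ((v x \<tau>)\<^sup>2 - (v x t)\<^sup>2) / (\<tau> - t) + ?q \<tau> x * (w x \<tau> + w x t)) (at x within {0..s t})"
          by (simp add: power2_eq_square algebra_simps
              flip: has_real_derivative_iff_has_vector_derivative)
      qed (use s_pos[of t] t in simp)
      moreover have "integral {0..s t}
            (\<lambda>x. ((v x \<tau>)\<^sup>2 - (v x t)\<^sup>2) / (\<tau> - t) + ?q \<tau> x * (w x \<tau> + w x t))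
          = integral {0..s t} (\<lambda>x. ((v x \<tau>)\<^sup>2 - (v x t)\<^sup>2) / (\<tau> - t))
          + integral {0..s t} (\<lambda>x. ?q \<tau> x * (w x \<tau> + w x t))"
        using elim
        by (intro Henstock_Kurzweil_Integration.integral_add integrable_continuous_interval
            continuous_intros slices) auto
      ultimately show ?case by (simp only: integral_unique)
    qed
  qed
  from moving_integral_right_derivative[OF cont t this] show ?thesis
    by (simp add: w_at_interface[OF t] power2_eq_square power3_eq_cube algebra_simps)
qed

text \<open>Rescaling the interval to \<open>[0, 1]\<close> makes this a parameter integral over a fixed domain.\<close>
lemma continuous_on_moving_integral:
  fixes f :: "real \<Rightarrow> real \<Rightarrow> real"
  assumes cont: "continuous_on (moving_domain s) (\<lambda>(x, t). f x t)"
  shows "continuous_on {0..} (\<lambda>t. integral {0..s t} (\<lambda>x. f x t))"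
proof -
  have *: "continuous_on ({0..} \<times> cbox 0 1) (\<lambda>(t, y). f (s t * y) t)"
  proof -
    have s': "continuous_on ({0..} \<times> cbox 0 1) (\<lambda>p. s (fst p))"
      by (rule continuous_on_compose2[OF continuous_on_s]) (auto intro!: continuous_intros)
    have "continuous_on ({0..} \<times> cbox 0 1)
        (\<lambda>p. case (s (fst p) * snd p, fst p) of (x, t) \<Rightarrow> f x t)"
    proof (rule continuous_on_compose2[OF cont])
      show "continuous_on ({0..} \<times> cbox 0 1) (\<lambda>p. (s (fst p) * snd p, fst p))"
        by (intro continuous_intros s')
      show "(\<lambda>p. (s (fst p) * snd p, fst p)) ` ({0..} \<times> cbox 0 1) \<subseteq> moving_domain s"
      proof (clarsimp simp: moving_domain_def)
        fix t y :: real assume "0 \<le> t" "0 \<le> y" "y \<le> 1"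
        then show "0 \<le> s t * y \<and> s t * y \<le> s t"
          using s_pos[of t] mult_left_le[of y "s t"] by auto
      qed
    qed
    then show ?thesis by (simp add: case_prod_beta)
  qed
  have "continuous_on {0..} (\<lambda>t. integral (cbox 0 1) (\<lambda>y. f (s t * y) t))"
    using integral_continuous_on_param[OF *] .
  then have "continuous_on {0..} (\<lambda>t. s t * integral (cbox 0 1) (\<lambda>y. f (s t * y) t))"
    by (intro continuous_intros continuous_on_s)
  moreover have "s t * integral (cbox 0 1) (\<lambda>y. f (s t * y) t) = integral {0..s t} (\<lambda>x. f x t)"
    if "t \<in> {0..}" for t
    using integral_stretch_real[of "s t" 0 "s t" "\<lambda>x. f x t"] s_pos[of t] that by simp
  ultimately show ?thesis by (rule continuous_on_eq)
qed

end

section \<open>The closed loop and its energy balance\<close>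

text \<open>
  The heat flow under the filtered feedback in the physical regime: positive temperature excess,
  interface short of the target \<open>S\<close>.  The gain \<open>\<kappa>\<close> is the product \<open>K H\<close>.
\<close>
locale stefan_closed_loop = expanding_heat_flow +
  fixes S c \<kappa> :: real
  assumes c_pos: "0 < c" and \<kappa>_pos: "0 < \<kappa>"
    and s_less: "0 \<le> t \<Longrightarrow> s t < S"
    and liquid: "0 \<le> t \<Longrightarrow> x \<in> {0<..<s t} \<Longrightarrow> 0 < u x t"
    and feedback: "0 \<le> t \<Longrightarrow> ((\<lambda>\<tau>. v 0 \<tau>) has_real_derivative
      - c * v 0 t + c * \<kappa> * ((s t - S) + integral {0..s t} (\<lambda>x. u x t))) (at t within {0..})"
begin

definition inflow :: "real \<Rightarrow> real" where
  "inflow t = - v 0 t"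

definition enthalpy :: "real \<Rightarrow> real" where
  "enthalpy t = (s t - S) + integral {0..s t} (\<lambda>x. u x t)"

definition grad_energy :: "real \<Rightarrow> real" where
  "grad_energy t = integral {0..s t} (\<lambda>x. (v x t)\<^sup>2)"

lemma S_pos: "0 < S"
  using s_pos[of 0] s_less[of 0] by simp

lemma slice_u: "0 \<le> t \<Longrightarrow> continuous_on {0..s t} (\<lambda>x. u x t)"
  by (rule continuous_on_slice[OF cont_u]) (auto simp: moving_domain_def)

lemma slice_v: "0 \<le> t \<Longrightarrow> continuous_on {0..s t} (\<lambda>x. v x t)"
  by (rule continuous_on_slice[OF cont_v]) (auto simp: moving_domain_def)

lemma grad_energy_nonneg: "0 \<le> t \<Longrightarrow> 0 \<le> grad_energy t"
  unfolding grad_energy_def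
  by (intro integral_nonneg integrable_continuous_interval continuous_intros slice_v) auto

lemma u_nonneg: "0 \<le> t \<Longrightarrow> x \<in> {0..s t} \<Longrightarrow> 0 \<le> u x t"
  using continuous_ge_on_closure[of "{0<..<s t}" "\<lambda>x. u x t" x 0] s_pos[of t] slice_u[of t]
    liquid[of t]
  by (fastforce simp: closure_greaterThanLessThan less_imp_le)

lemma continuous_on_inflow: "continuous_on {0..} inflow"
  unfolding inflow_def
  by (intro continuous_intros DERIV_continuous_on) (use feedback in auto)

lemma continuous_on_enthalpy: "continuous_on {0..} enthalpy"
  unfolding enthalpy_def
    by (intro continuous_intros continuous_on_s continuous_on_moving_integral cont_u)

lemma continuous_on_grad_energy: "continuous_on {0..} grad_energy"
proof -
  have "continuous_on (moving_domain s) (\<lambda>z. (case z of (x, t) \<Rightarrow> v x t)\<^sup>2)"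
    by (intro continuous_intros cont_v)
  then have "continuous_on (moving_domain s) (\<lambda>(x, t). (v x t)\<^sup>2)"
    by (simp add: case_prod_beta)
  then show ?thesis
    unfolding grad_energy_def by (rule continuous_on_moving_integral)
qed

lemma continuous_on_u0: "continuous_on {0..} (u 0)"
proof -
  have "continuous_on {0..} (\<lambda>t. case (0, t) of (x, t) \<Rightarrow> u x t)"
    by (rule continuous_on_compose2[OF cont_u])
      (auto intro!: continuous_intros simp: moving_domain_def less_imp_le s_pos)
  then show ?thesis by simp
qed

text \<open>
  The moment identity with \<open>\<phi> = 1\<close>: the heat flux leaving the liquid at the interface is exactly
  what the advance of the interface consumes.
\<close>
lemma enthalpy_deriv: "0 < t \<Longrightarrow> (enthalpy has_real_derivative inflow t) (at_right t)"
  unfolding enthalpy_def inflow_def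
  using moment_right_derivative[of t "\<lambda>x. 1" "\<lambda>x. 0" 0] s_right_derivative[of t]
  by (auto intro!: derivative_eq_intros)

lemma inflow_deriv: "0 < t \<Longrightarrow> (inflow
    has_real_derivative - c * inflow t - c * \<kappa> * enthalpy t) (at_right t)"
  unfolding inflow_def enthalpy_def
  using DERIV_minus[OF DERIV_subset[OF feedback[of t], of "{t<..}"]]
  by (simp add: greaterThan_subset_iff algebra_simps subset_iff)

text \<open>Poincare's inequality, using that \<open>u\<close> vanishes at the interface and \<open>s t < S\<close>.\<close>
lemma u_sq_le:
  assumes t: "0 \<le> t" and x: "x \<in> {0..s t}"
  shows "(u x t)\<^sup>2 \<le> S * grad_energy t"
proof -
  have "(u x t - u (s t) t)\<^sup>2 \<le> s t * grad_energy t"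
    unfolding grad_energy_def using s_pos[OF t] x
    by (intro increment_sq_le_integral_deriv_sq u_x slice_v t) auto
  also have "\<dots> \<le> S * grad_energy t"
    using s_less[OF t] grad_energy_nonneg[OF t] by (intro mult_right_mono) auto
  finally show ?thesis using dirichlet[OF t] by simp
qed

lemma integral_u_sq_le:
  assumes t: "0 \<le> t"
  shows "integral {0..s t} (\<lambda>x. (u x t)\<^sup>2) \<le> S\<^sup>2 * grad_energy t"
proof -
  have "norm (integral {0..s t} (\<lambda>x. (u x t)\<^sup>2)) \<le> S * grad_energy t * (s t - 0)"
    using s_pos[OF t] u_sq_le[OF t] by (intro integral_bound continuous_intros slice_u t) auto
  also have "\<dots> \<le> S * grad_energy t * S"
    using s_less[OF t] S_pos grad_energy_nonneg[OF t] by (intro mult_left_mono) auto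
  finally show ?thesis by (simp add: power2_eq_square algebra_simps)
qed

lemma heat_content_sq_le:
  assumes t: "0 \<le> t"
  shows "(integral {0..s t} (\<lambda>x. u x t))\<^sup>2 \<le> S ^ 3 * grad_energy t"
proof -
  have "norm (u x t) \<le> sqrt (S * grad_energy t)" if "x \<in> {0..s t}" for x
    using real_sqrt_le_mono[OF u_sq_le[OF t that]] by simp
  then have "norm (integral {0..s t} (\<lambda>x. u x t)) \<le> sqrt (S * grad_energy t) * (s t - 0)"
    using s_pos[OF t] by (intro integral_bound slice_u t) auto
  also have "\<dots> \<le> sqrt (S * grad_energy t) * S"
    using s_less[OF t] S_pos grad_energy_nonneg[OF t] by (intro mult_left_mono) auto
  finally have "(norm (integral {0..s t} (\<lambda>x. u x t)))\<^sup>2 \<le> (sqrt (S * grad_energy t) * S)\<^sup>2"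
    by (rule power_mono) simp
  also have "(sqrt (S * grad_energy t) * S)\<^sup>2 = S ^ 3 * grad_energy t"
    using S_pos grad_energy_nonneg[OF t]
    by (simp add: power_mult_distrib) (simp add: power2_eq_square power3_eq_cube)
  finally show ?thesis by simp
qed

lemma displacement_sq_le: "0 \<le> t \<Longrightarrow> (s t - S)\<^sup>2 \<le> 2 * (enthalpy t)\<^sup>2 + 2 * S ^ 3 * grad_energy t"
proof -
  assume t: "0 \<le> t"
  have "(s t - S)\<^sup>2 = (enthalpy t - integral {0..s t} (\<lambda>x. u x t))\<^sup>2"
    by (simp add: enthalpy_def)
  also have "\<dots> \<le> 2 * (enthalpy t)\<^sup>2 + 2 * (integral {0..s t} (\<lambda>x. u x t))\<^sup>2"
    using sum_squares_bound[of "enthalpy t" "- integral {0..s t} (\<lambda>x. u x t)"]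
    by (simp add: power2_diff)
  finally show ?thesis using heat_content_sq_le[OF t] by simp
qed

lemma enthalpy_sq_le: "0 \<le> t \<Longrightarrow> (enthalpy t)\<^sup>2 \<le> 2 * (s t - S)\<^sup>2 + 2 * S ^ 3 * grad_energy t"
proof -
  assume t: "0 \<le> t"
  have "(enthalpy t)\<^sup>2 \<le> 2 * (s t - S)\<^sup>2 + 2 * (integral {0..s t} (\<lambda>x. u x t))\<^sup>2"
    unfolding enthalpy_def
    using sum_squares_bound[of "s t - S" "integral {0..s t} (\<lambda>x. u x t)"]
    by (simp add: power2_sum)
  then show ?thesis using heat_content_sq_le[OF t] by simp
qed

text \<open>Poincare's inequality for the gradient, whose value at the fixed end is \<open>- U\<close>.\<close>
lemma grad_energy_le:
  assumes t: "0 < t"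
  shows "grad_energy t \<le> 2 * S * (inflow t)\<^sup>2 + 2 * S\<^sup>2 * integral {0..s t} (\<lambda>x. (w x t)\<^sup>2)"
proof -
  let ?I = "integral {0..s t} (\<lambda>x. (w x t)\<^sup>2)"
  have t': "0 \<le> t" using t by simp
  have sl: "continuous_on {0..s t} (\<lambda>x. w x t)" using continuous_slice[OF cont_w t order_refl] .
  have I: "0 \<le> ?I"
    by (intro integral_nonneg integrable_continuous_interval continuous_intros sl) auto
  have "norm ((v x t)\<^sup>2) \<le> 2 * (inflow t)\<^sup>2 + 2 * S * ?I" if x: "x \<in> {0..s t}" for x
  proof -
    have "(v x t - v 0 t)\<^sup>2 \<le> s t * ?I"
      using s_pos[OF t'] x by (intro increment_sq_le_integral_deriv_sq v_x t sl) auto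
    also have "\<dots> \<le> S * ?I" using s_less[OF t'] I by (intro mult_right_mono) auto
    finally have "(v x t - v 0 t)\<^sup>2 \<le> S * ?I" .
    moreover have "(v x t)\<^sup>2 \<le> 2 * (inflow t)\<^sup>2 + 2 * (v x t - v 0 t)\<^sup>2"
      using zero_le_power2[of "v x t - 2 * v 0 t"]
        by (simp add: inflow_def power2_eq_square algebra_simps)
    ultimately show ?thesis by simp
  qed
  then have "norm (grad_energy t) \<le> (2 * (inflow t)\<^sup>2 + 2 * S * ?I) * (s t - 0)"
    unfolding grad_energy_def using s_pos[OF t']
      by (intro integral_bound continuous_intros slice_v t') auto
  also have "\<dots> \<le> (2 * (inflow t)\<^sup>2 + 2 * S * ?I) * S"
    using s_less[OF t'] S_pos I by (intro mult_left_mono) auto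
  finally show ?thesis by (simp add: power2_eq_square algebra_simps)
qed

section \<open>The Lyapunov functional\<close>

text \<open>
  The coefficients are those for which the mixed term \<open>U E\<close> cancels in the derivative along
  \<open>E' = U\<close>, \<open>U' = - c U - c \<kappa> E\<close>.
\<close>
definition ode_form :: "real \<Rightarrow> real" where
  "ode_form t = (inflow t)\<^sup>2 + c * inflow t * enthalpy t + (c * \<kappa> + c\<^sup>2 / 2) * (enthalpy t)\<^sup>2"

text \<open>
  The correction absorbs the boundary term \<open>2 U u\<^sub>t(0)\<close> in the derivative of the gradient energy,
  which no norm at hand controls: it turns it into the harmless \<open>- 2 U' u(0)\<close>.
\<close>
definition grad_form :: "real \<Rightarrow> real" where
  "grad_form t = grad_energy t - 2 * inflow t * u 0 t"

lemma continuous_on_ode_form: "continuous_on {0..} ode_form"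
  unfolding ode_form_def by (intro continuous_intros continuous_on_inflow continuous_on_enthalpy)

lemma continuous_on_grad_form: "continuous_on {0..} grad_form"
  unfolding grad_form_def
    by (intro continuous_intros continuous_on_inflow continuous_on_grad_energy continuous_on_u0)

lemma ode_form_deriv:
  assumes "0 < t"
  shows "(ode_form has_real_derivative - c * (inflow t)\<^sup>2 - c\<^sup>2 * \<kappa> * (enthalpy t)\<^sup>2) (at_right t)"
  unfolding ode_form_def
  by (rule derivative_eq_intros inflow_deriv[OF assms] enthalpy_deriv[OF assms] refl)+
    (simp add: power2_eq_square algebra_simps)

lemma ode_form_ge: "(inflow t)\<^sup>2 / 4 + (c\<^sup>2 / 6 + c * \<kappa>) * (enthalpy t)\<^sup>2 \<le> ode_form t"
proof -
  have "ode_form t - ((inflow t)\<^sup>2 / 4 + (c\<^sup>2 / 6 + c * \<kappa>) * (enthalpy t)\<^sup>2)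
      = 3 / 4 * (inflow t + 2 / 3 * c * enthalpy t)\<^sup>2"
    by (simp add: ode_form_def power2_eq_square algebra_simps)
  then show ?thesis by (smt (verit) zero_le_power2 mult_nonneg_nonneg divide_nonneg_nonneg)
qed

lemma ode_form_le: "ode_form t \<le> 3 / 2 * (inflow t)\<^sup>2 + (c * \<kappa> + c\<^sup>2) * (enthalpy t)\<^sup>2"
proof -
  have "3 / 2 * (inflow t)\<^sup>2 + (c * \<kappa> + c\<^sup>2) * (enthalpy t)\<^sup>2 - ode_form t
      = 1 / 2 * (inflow t - c * enthalpy t)\<^sup>2"
    by (simp add: ode_form_def power2_eq_square algebra_simps)
  then show ?thesis by (smt (verit) zero_le_power2 mult_nonneg_nonneg divide_nonneg_nonneg)
qed

text \<open>Young's inequality, weighted for products of a number with a boundary value \<open>u 0 t\<close>.\<close>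
lemma cross_term_le:
  fixes a b p :: real
  assumes "b\<^sup>2 \<le> S * p"
  shows "\<bar>2 * a * b\<bar> \<le> 2 * S * a\<^sup>2 + p / 2"
proof -
  have "\<bar>2 * a * b\<bar> * (2 * S) \<le> 4 * S\<^sup>2 * a\<^sup>2 + b\<^sup>2"
  proof -
    have "0 \<le> (2 * S * \<bar>a\<bar> - \<bar>b\<bar>)\<^sup>2" by simp
    then show ?thesis using S_pos by (simp add: power2_eq_square algebra_simps abs_mult)
  qed
  also have "\<dots> \<le> (2 * S * a\<^sup>2 + p / 2) * (2 * S)"
    using assms by (simp add: power2_eq_square algebra_simps)
  finally show ?thesis using S_pos by simp
qed

lemma grad_form_bounds:
  assumes t: "0 \<le> t"
  shows "grad_energy t / 2 - 2 * S * (inflow t)\<^sup>2 \<le> grad_form t"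
    "grad_form t \<le> 3 / 2 * grad_energy t + 2 * S * (inflow t)\<^sup>2"
  using cross_term_le[OF u_sq_le[OF t, of 0], of "inflow t"] s_pos[OF t]
    by (auto simp: grad_form_def abs_le_iff)

text \<open>
  Half of the dissipation obtained from Poincare's inequality pays for the term \<open>2 U' u(0)\<close>; the
  cubic interface term has the good sign because the interface advances.
\<close>
lemma grad_form_deriv:
  assumes t: "0 < t"
  obtains D where "(grad_form has_real_derivative D) (at_right t)"
    "D \<le> - (grad_energy t / (2 * S\<^sup>2)) + (2 / S + 4 * c\<^sup>2 * S ^ 3) * (inflow t)\<^sup>2
        + 4 * c\<^sup>2 * S ^ 3 * \<kappa>\<^sup>2 * (enthalpy t)\<^sup>2"
proof
  let ?I = "integral {0..s t} (\<lambda>x. (w x t)\<^sup>2)"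
  let ?D = "(v (s t) t) ^ 3 - 2 * ?I + 2 * c * (inflow t + \<kappa> * enthalpy t) * u 0 t"
  have t': "0 \<le> t" using t by simp
  have "((\<lambda>\<tau>. u 0 \<tau>) has_real_derivative w 0 t) (at_right t)"
    using tendsto_uniform_limitI[OF uniform_limit_time_quotient[OF t], of 0] s_pos[of t] t
    by (simp add: has_field_derivative_iff)
  note u0 = this
  have "(grad_energy has_real_derivative (v (s t) t) ^ 3
      + 2 * w 0 t * inflow t - 2 * ?I) (at_right t)"
    using dirichlet_energy_right_derivative[OF t] by (simp add: inflow_def grad_energy_def[abs_def])
  from DERIV_diff[OF this DERIV_mult[OF DERIV_cmult[OF inflow_deriv[OF t], of 2] u0]]
  show "(grad_form has_real_derivative ?D) (at_right t)"
    unfolding grad_form_def[abs_def] by (simp add: algebra_simps)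
  have "(v (s t) t) ^ 3 \<le> 0"
    using outflow[OF t'] by (simp add: power3_eq_cube mult_nonneg_nonpos mult_nonpos_nonpos)
  moreover have "- 2 * ?I \<le> - (grad_energy t / S\<^sup>2) + 2 / S * (inflow t)\<^sup>2"
    using grad_energy_le[OF t] S_pos by (simp add: field_simps power2_eq_square)
  moreover have "2 * c * (inflow t + \<kappa> * enthalpy t) * u 0 t \<le>
      4 * c\<^sup>2 * S ^ 3 * (inflow t)\<^sup>2 + 4 * c\<^sup>2 * S ^ 3 * \<kappa>\<^sup>2 * (enthalpy t)\<^sup>2
          + grad_energy t / (2 * S\<^sup>2)"
  proof -
    \<comment> \<open>The factor \<open>S\<^sup>2\<close> makes Young's inequality use up half of the dissipation.\<close>
    let ?a = "S\<^sup>2 * c * (inflow t + \<kappa> * enthalpy t)"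
    have "S\<^sup>2 * (2 * c * (inflow t + \<kappa> * enthalpy t) * u 0 t) \<le> 2 * S * ?a\<^sup>2 + grad_energy t / 2"
      using cross_term_le[OF u_sq_le[OF t', of 0], of ?a] s_pos[OF t']
      by (auto simp: algebra_simps)
    also have "?a\<^sup>2 \<le> S ^ 4 * c\<^sup>2 * (2 * (inflow t)\<^sup>2 + 2 * \<kappa>\<^sup>2 * (enthalpy t)\<^sup>2)"
    proof -
      have "(inflow t + \<kappa> * enthalpy t)\<^sup>2 \<le> 2 * (inflow t)\<^sup>2 + 2 * \<kappa>\<^sup>2 * (enthalpy t)\<^sup>2"
        using sum_squares_bound[of "inflow t" "\<kappa> * enthalpy t"]
          by (simp add: power2_sum power_mult_distrib)
      then have "S ^ 4 * c\<^sup>2 * (inflow t + \<kappa> * enthalpy t)\<^sup>2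
          \<le> S ^ 4 * c\<^sup>2 * (2 * (inflow t)\<^sup>2 + 2 * \<kappa>\<^sup>2 * (enthalpy t)\<^sup>2)"
        by (intro mult_left_mono) auto
      then show ?thesis by (simp add: power_mult_distrib)
    qed
    also have "2 * S * (S ^ 4 * c\<^sup>2 * (2 * (inflow t)\<^sup>2 + 2 * \<kappa>\<^sup>2 * (enthalpy t)\<^sup>2))
        + grad_energy t / 2 = S\<^sup>2 *
        (4 * c\<^sup>2 * S ^ 3 * (inflow t)\<^sup>2 + 4 * c\<^sup>2 * S ^ 3 * \<kappa>\<^sup>2 * (enthalpy t)\<^sup>2
            + grad_energy t / (2 * S\<^sup>2))"
      using S_pos by (simp add: field_simps power2_eq_square power3_eq_cube power4_eq_xxxx)
    finally show ?thesis using S_pos by (simp add: mult_le_cancel_left)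
  qed
  moreover have "grad_energy t / S\<^sup>2
      = grad_energy t / (2 * S\<^sup>2) + grad_energy t / (2 * S\<^sup>2)" by simp
  ultimately show "?D \<le> - (grad_energy t / (2 * S\<^sup>2)) + (2 / S + 4 * c\<^sup>2 * S ^ 3) * (inflow t)\<^sup>2
      + 4 * c\<^sup>2 * S ^ 3 * \<kappa>\<^sup>2 * (enthalpy t)\<^sup>2"
    unfolding distrib_right[of "2 / S"] by linarith
qed

definition state_size :: "real \<Rightarrow> real" where
  "state_size t = grad_energy t + (inflow t)\<^sup>2 + (enthalpy t)\<^sup>2"

text \<open>
  In \<open>A V + Q\<close> the dissipation \<open>A V'\<close> has to outweigh the source terms \<open>U\<^sup>2\<close> and \<open>E\<^sup>2\<close> of \<open>Q'\<close>,
  and \<open>A V\<close> the negative part of \<open>Q\<close>; these are the lower bounds on \<open>A\<close>.  The constants \<open>B\<close> and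
  \<open>m\<close> come from the upper bound on the functional and from its dissipation.
\<close>
lemma lyapunov_decay:
  assumes A: "0 \<le> A" "2 * S + 1 \<le> A / 4" "2 / S + 4 * c\<^sup>2 * S ^ 3 + 1 \<le> A * c"
      "4 * c\<^sup>2 * S ^ 3 * \<kappa>\<^sup>2 + 1 \<le> A * (c\<^sup>2 * \<kappa>)" "1 \<le> A * (c\<^sup>2 / 6 + c * \<kappa>)"
    and B: "3 / 2 \<le> B" "A * (3 / 2) + 2 * S \<le> B" "A * (c * \<kappa> + c\<^sup>2) \<le> B"
    and m: "0 < m" "m \<le> 1" "m \<le> 1 / (2 * S\<^sup>2)"
    and t: "0 \<le> t"
  shows "state_size t \<le> 2 * B * state_size 0 * exp (- (m / B) * t)"
proof -
  define L where "L t = A * ode_form t + grad_form t" for t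
  have L_ge: "state_size \<tau> / 2 \<le> L \<tau>" if \<tau>: "0 \<le> \<tau>" for \<tau>
  proof -
    have "A * ((inflow \<tau>)\<^sup>2 / 4 + (c\<^sup>2 / 6 + c * \<kappa>) * (enthalpy \<tau>)\<^sup>2) \<le> A * ode_form \<tau>"
      using A(1) ode_form_ge by (rule mult_left_mono[rotated])
    moreover have "(2 * S + 1) * (inflow \<tau>)\<^sup>2 \<le> A / 4 * (inflow \<tau>)\<^sup>2"
      using A(2) by (intro mult_right_mono) auto
    moreover have "1 * (enthalpy \<tau>)\<^sup>2 \<le> A * (c\<^sup>2 / 6 + c * \<kappa>) * (enthalpy \<tau>)\<^sup>2"
      using A(5) by (intro mult_right_mono) auto
    ultimately have "grad_energy \<tau> / 2 + (inflow \<tau>)\<^sup>2 + (enthalpy \<tau>)\<^sup>2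
        \<le> A * ode_form \<tau> + grad_form \<tau>"
      using grad_form_bounds(1)[OF \<tau>] by (simp add: algebra_simps)
    then show ?thesis
      unfolding L_def state_size_def
      using zero_le_power2[of "inflow \<tau>"] zero_le_power2[of "enthalpy \<tau>"] by argo
  qed
  have L_le: "L \<tau> \<le> B * state_size \<tau>" if \<tau>: "0 \<le> \<tau>" for \<tau>
  proof -
    have "A * ode_form \<tau> \<le> A * (3 / 2 * (inflow \<tau>)\<^sup>2 + (c * \<kappa> + c\<^sup>2) * (enthalpy \<tau>)\<^sup>2)"
      using A(1) ode_form_le by (rule mult_left_mono[rotated])
    moreover have "3 / 2 * grad_energy \<tau> \<le> B * grad_energy \<tau>"
      using B(1) grad_energy_nonneg[OF \<tau>] by (intro mult_right_mono)
    moreover have "(A * (3 / 2) + 2 * S) * (inflow \<tau>)\<^sup>2 \<le> B * (inflow \<tau>)\<^sup>2"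
      using B(2) by (intro mult_right_mono) auto
    moreover have "A * (c * \<kappa> + c\<^sup>2) * (enthalpy \<tau>)\<^sup>2 \<le> B * (enthalpy \<tau>)\<^sup>2"
      using B(3) by (intro mult_right_mono) auto
    ultimately show ?thesis
      unfolding L_def state_size_def using grad_form_bounds(2)[OF \<tau>] by (simp add: algebra_simps)
  qed
  have "\<exists>D. (L has_real_derivative D) (at_right \<tau>) \<and> D \<le> - (m / B) * L \<tau>" if \<tau>: "0 < \<tau>" for \<tau>
  proof -
    obtain D where D: "(grad_form has_real_derivative D) (at_right \<tau>)"
      "D \<le> - (grad_energy \<tau> / (2 * S\<^sup>2)) + (2 / S + 4 * c\<^sup>2 * S ^ 3) * (inflow \<tau>)\<^sup>2
        + 4 * c\<^sup>2 * S ^ 3 * \<kappa>\<^sup>2 * (enthalpy \<tau>)\<^sup>2"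
      using grad_form_deriv[OF \<tau>] by blast
    let ?D = "A * (- c * (inflow \<tau>)\<^sup>2 - c\<^sup>2 * \<kappa> * (enthalpy \<tau>)\<^sup>2) + D"
    have "(L has_real_derivative ?D) (at_right \<tau>)"
      unfolding L_def[abs_def] by (intro DERIV_add DERIV_cmult ode_form_deriv \<tau> D(1))
    moreover have "?D \<le> - (m / B) * L \<tau>"
    proof -
      have "(2 / S + 4 * c\<^sup>2 * S ^ 3 + 1) * (inflow \<tau>)\<^sup>2 \<le> A * c * (inflow \<tau>)\<^sup>2"
        "(4 * c\<^sup>2 * S ^ 3 * \<kappa>\<^sup>2 + 1) * (enthalpy \<tau>)\<^sup>2 \<le> A * (c\<^sup>2 * \<kappa>) * (enthalpy \<tau>)\<^sup>2"
        using A(3,4) by (auto intro!: mult_right_mono)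
      moreover have "m * grad_energy \<tau> \<le> 1 / (2 * S\<^sup>2) * grad_energy \<tau>" "m * (inflow \<tau>)\<^sup>2
          \<le> 1 * (inflow \<tau>)\<^sup>2"
        "m * (enthalpy \<tau>)\<^sup>2 \<le> 1 * (enthalpy \<tau>)\<^sup>2"
        using mult_right_mono[OF m(3), of "grad_energy \<tau>"] mult_right_mono[OF m(2), of "(inflow \<tau>)\<^sup>2"]
          mult_right_mono[OF m(2), of "(enthalpy \<tau>)\<^sup>2"] grad_energy_nonneg[of \<tau>] \<tau> by auto
      ultimately have "?D \<le> - m * state_size \<tau>"
        using D(2) unfolding state_size_def
          by (simp add: distrib_left distrib_right right_diff_distrib mult.assoc)
      also have "m / B * L \<tau> \<le> m / B * (B * state_size \<tau>)"
        using L_le[of \<tau>] \<tau> m B(1) by (intro mult_left_mono) auto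
      then have "- m * state_size \<tau> \<le> - (m / B) * L \<tau>" using B(1) by simp
      finally show ?thesis .
    qed
    ultimately show ?thesis by blast
  qed
  then obtain D where D: "\<And>\<tau>. 0 < \<tau> \<Longrightarrow> (L has_real_derivative D \<tau>) (at_right \<tau>)"
    "\<And>\<tau>. 0 < \<tau> \<Longrightarrow> D \<tau> \<le> - (m / B) * L \<tau>" by metis
  have "continuous_on {0..} L"
    unfolding L_def[abs_def]
      by (intro continuous_intros continuous_on_ode_form continuous_on_grad_form)
  then have "L t \<le> L 0 * exp (- (m / B) * t)"
    by (rule right_gronwall[OF _ D t])
  also have "\<dots> \<le> B * state_size 0 * exp (- (m / B) * t)"
    using L_le[of 0] by (intro mult_right_mono) auto
  finally show ?thesis using L_ge[OF t] by simp
qed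

section \<open>Control of the initial flux by the initial state\<close>

lemma energy_and_input_bounded:
  obtains b where "\<And>t. 0 \<le> t \<Longrightarrow> \<bar>enthalpy t\<bar> \<le> b" "\<And>t. 0 \<le> t \<Longrightarrow> \<bar>inflow t\<bar> \<le> b"
proof
  fix t :: real assume t: "0 \<le> t"
  have dissipation: "- c * (inflow \<tau>)\<^sup>2 - c\<^sup>2 * \<kappa> * (enthalpy \<tau>)\<^sup>2
      \<le> 0 * ode_form \<tau>" if "0 < \<tau>" for \<tau>
  proof -
    have "0 \<le> c * (inflow \<tau>)\<^sup>2 + c\<^sup>2 * \<kappa> * (enthalpy \<tau>)\<^sup>2"
      using c_pos \<kappa>_pos by (intro add_nonneg_nonneg mult_nonneg_nonneg) auto
    then show ?thesis by linarith
  qed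
  have "ode_form t \<le> ode_form 0 * exp (0 * t)"
    by (rule right_gronwall[OF continuous_on_ode_form ode_form_deriv _ t]) (use dissipation in auto)
  then have ode_form: "ode_form t \<le> ode_form 0" by simp
  let ?k = "c\<^sup>2 / 6 + c * \<kappa>"
  let ?b = "sqrt (ode_form 0 / ?k) + sqrt (4 * ode_form 0)"
  have k: "0 < ?k" using c_pos \<kappa>_pos by (simp add: add_pos_pos)
  have "?k * (enthalpy t)\<^sup>2 \<le> ode_form 0" "(inflow t)\<^sup>2 / 4 \<le> ode_form 0"
    using ode_form_ge[of t] ode_form k zero_le_power2[of "inflow t"]
      mult_nonneg_nonneg[OF less_imp_le[OF k] zero_le_power2[of "enthalpy t"]]
    by argo+
  then have "(enthalpy t)\<^sup>2 \<le> ode_form 0 / ?k" "(inflow t)\<^sup>2 \<le> 4 * ode_form 0" using k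
    by (auto simp: field_simps)
  then have "\<bar>enthalpy t\<bar> \<le> sqrt (ode_form 0 / ?k)" "\<bar>inflow t\<bar> \<le> sqrt (4 * ode_form 0)"
    using real_sqrt_le_mono by fastforce+
  moreover have "0 \<le> sqrt (ode_form 0 / ?k)" "0 \<le> sqrt (4 * ode_form 0)"
    using calculation abs_ge_zero order_trans by blast+
  ultimately show "\<bar>enthalpy t\<bar> \<le> ?b" "\<bar>inflow t\<bar> \<le> ?b" by linarith+
qed

text \<open>The moment for the eigenfunction \<open>cosh'' = cosh\<close>; without inputs it would grow like \<open>exp t\<close>.\<close>
definition cosh_moment where
  "cosh_moment t = integral {0..s t} (\<lambda>x. cosh x * u x t)"

lemma cosh_moment_bounds:
  assumes t: "0 \<le> t"
  shows "0 \<le> cosh_moment t" "cosh_moment t \<le> cosh S * integral {0..s t} (\<lambda>x. u x t)"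
proof -
  have c: "continuous_on A (cosh :: real \<Rightarrow> real)" for A by (intro continuous_intros)
  show "0 \<le> cosh_moment t"
    unfolding cosh_moment_def
    by (intro integral_nonneg integrable_continuous_interval continuous_intros slice_u t
        mult_nonneg_nonneg u_nonneg) (auto simp: cosh_real_nonneg)
  have "cosh_moment t \<le> integral {0..s t} (\<lambda>x. cosh S * u x t)"
    unfolding cosh_moment_def
  proof (intro integral_le integrable_continuous_interval continuous_intros slice_u t)
    fix x assume x: "x \<in> {0..s t}"
    show "cosh x * u x t \<le> cosh S * u x t"
      using x s_less[OF t] u_nonneg[OF t x]
        by (intro mult_right_mono) (auto simp: cosh_real_nonneg_le_iff)
  qed
  then show "cosh_moment t \<le> cosh S * integral {0..s t} (\<lambda>x. u x t)" by simp
qed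

lemma cosh_moment_deriv:
  assumes t: "0 < t"
  shows "(cosh_moment has_real_derivative cosh_moment t + cosh (s t) * v (s t) t
      + inflow t) (at_right t)"
proof -
  have "(cosh has_real_derivative sinh x) (at x)" "(sinh has_real_derivative 1 * cosh x) (at x)"
    for x :: real
    by (auto intro!: derivative_eq_intros)
  from moment_right_derivative[OF t this] show ?thesis
    by (simp add: cosh_moment_def[abs_def] inflow_def)
qed

text \<open>The characteristic polynomial \<open>p\<^sup>2 + c p + c \<kappa>\<close> of the planar system at \<open>p = 1\<close>.\<close>
definition mode_denom :: real where
  "mode_denom = 1 + c + c * \<kappa>"

text \<open>
  The enthalpy and the flux are added with the coefficients that remove both from the equation
  for the moment, which leaves a scalar equation driven by the interface speed alone.
\<close>
definition growing_mode :: "real \<Rightarrow> real" where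
  "growing_mode t = cosh_moment t - c * \<kappa> / mode_denom * enthalpy t + inflow t / mode_denom"

lemma mode_denom_pos: "0 < mode_denom"
  using c_pos \<kappa>_pos by (simp add: mode_denom_def add_pos_pos)

lemma growing_mode_deriv:
  assumes "0 < t"
  shows "(growing_mode has_real_derivative growing_mode t + cosh (s t) * v (s t) t) (at_right t)"
proof -
  have "(growing_mode has_real_derivative (cosh_moment t + cosh (s t) * v (s t) t
      + inflow t) - c * \<kappa> / mode_denom * inflow t
      + (- c * inflow t - c * \<kappa> * enthalpy t) / mode_denom) (at_right t)"
    unfolding growing_mode_def[abs_def]
    by (intro DERIV_add DERIV_diff DERIV_cmult DERIV_cdivide
        cosh_moment_deriv enthalpy_deriv inflow_deriv assms)
  also have "(cosh_moment t + cosh (s t) * v (s t) t + inflow t) - c * \<kappa> / mode_denom * inflow t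
      + (- c * inflow t - c * \<kappa> * enthalpy t) / mode_denom
          = growing_mode t + cosh (s t) * v (s t) t"
    using mode_denom_pos
      by (simp add: growing_mode_def field_simps) (simp add: mode_denom_def algebra_simps)
  finally show ?thesis .
qed

lemma continuous_on_growing_mode: "continuous_on {0..} growing_mode"
proof -
  have c: "continuous_on A (\<lambda>p :: real \<times> real. cosh (fst p))" for A
    by (intro continuous_intros)
  have "continuous_on (moving_domain s) (\<lambda>z. cosh (fst z) * (case z of (x, t) \<Rightarrow> u x t))"
    by (intro continuous_intros c cont_u)
  then have "continuous_on (moving_domain s) (\<lambda>(x, t). cosh x * u x t)"
    by (simp add: case_prod_beta)
  then have "continuous_on {0..} cosh_moment"
    unfolding cosh_moment_def[abs_def] by (rule continuous_on_moving_integral)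
  then show ?thesis
    using mode_denom_pos unfolding growing_mode_def[abs_def]
    by (intro continuous_intros continuous_on_enthalpy continuous_on_inflow) auto
qed

text \<open>
  Positivity of \<open>u\<close> bounds the moment by the heat content, and the heat content is \<open>E - (s - S)\<close>,
  a difference of two bounded functions.
\<close>
lemma growing_mode_bounded:
  obtains b where "\<And>t. 0 \<le> t \<Longrightarrow> \<bar>growing_mode t\<bar> \<le> b"
proof -
  obtain b where b: "\<And>t. 0 \<le> t \<Longrightarrow> \<bar>enthalpy t\<bar> \<le> b" "\<And>t. 0 \<le> t \<Longrightarrow> \<bar>inflow t\<bar> \<le> b"
    using energy_and_input_bounded by blast
  show ?thesis
  proof
    fix t :: real assume t: "0 \<le> t"
    have "integral {0..s t} (\<lambda>x. u x t) \<le> b + S"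
      using b(1)[OF t] s_pos[OF t] s_less[OF t] by (simp add: enthalpy_def)
    then have "cosh S * integral {0..s t} (\<lambda>x. u x t) \<le> cosh S * (b + S)"
      by (intro mult_left_mono) (auto simp: cosh_real_nonneg)
    then have "\<bar>cosh_moment t\<bar> \<le> cosh S * (b + S)" using cosh_moment_bounds[OF t] by linarith
    moreover have "\<bar>c * \<kappa> / mode_denom * enthalpy t\<bar> \<le> c * \<kappa> / mode_denom * b"
      using b(1)[OF t] c_pos \<kappa>_pos mode_denom_pos by (simp add: abs_mult divide_right_mono)
    moreover have "\<bar>inflow t / mode_denom\<bar> \<le> b / mode_denom"
      using b(2)[OF t] mode_denom_pos by (simp add: divide_right_mono)
    ultimately show "\<bar>growing_mode t\<bar> \<le> cosh S * (b + S) + c * \<kappa> / mode_denom * b + b / mode_denom"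
      unfolding growing_mode_def by linarith
  qed
qed

text \<open>
  A negative initial value would make the mode tend to \<open>-\<infinity>\<close> exponentially, since an advancing
  interface can only decrease it further.
\<close>
lemma growing_mode_initial_nonneg: "0 \<le> growing_mode 0"
proof -
  obtain b where b: "\<And>t. 0 \<le> t \<Longrightarrow> \<bar>growing_mode t\<bar> \<le> b" using growing_mode_bounded by blast
  have "- b * exp (- t) \<le> growing_mode 0" if t: "0 \<le> t" for t
  proof -
    have "growing_mode t \<le> growing_mode 0 * exp (1 * t)"
    proof (rule right_gronwall[OF continuous_on_growing_mode growing_mode_deriv _ t])
      fix \<tau> :: real assume "0 < \<tau>"
      then show "growing_mode \<tau> + cosh (s \<tau>) * v (s \<tau>) \<tau> \<le> 1 * growing_mode \<tau>"
        using outflow[of \<tau>] by (simp add: mult_nonneg_nonpos cosh_real_nonneg)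
    qed
    then have "- b \<le> growing_mode 0 * exp t" using b[OF t] by auto
    then show ?thesis by (simp add: exp_minus field_simps)
  qed
  then have "\<forall>\<^sub>F t in at_top. - b * exp (- t) \<le> growing_mode 0"
    by (auto intro: eventually_mono[OF eventually_ge_at_top[of 0]])
  moreover have "((\<lambda>t :: real. - b * exp (- t)) \<longlongrightarrow> - b * 0) at_top"
    by (intro tendsto_intros filterlim_compose[OF exp_at_bot] filterlim_uminus_at_bot_at_top)
  ultimately show ?thesis using tendsto_upperbound by fastforce
qed

text \<open>
  The function \<open>exp (- t) W + cosh S s\<close> is nondecreasing, and its limit superior is at most
  \<open>cosh S S\<close>: the interface has only the distance \<open>S - s 0\<close> left to absorb a positive mode.
\<close>
lemma growing_mode_initial_le: "growing_mode 0 \<le> cosh S * (S - s 0)"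
proof -
  obtain b where b: "\<And>t. 0 \<le> t \<Longrightarrow> \<bar>growing_mode t\<bar> \<le> b" using growing_mode_bounded by blast
  have "growing_mode 0 \<le> b * exp (- t) + cosh S * (S - s 0)" if t: "0 \<le> t" for t
  proof -
    have decrease: "- (exp (- t) * growing_mode t + cosh S * s t)
        \<le> - (exp (- 0) * growing_mode 0 + cosh S * s 0)"
    proof (rule right_derivative_nonpos_imp_le[where f
        = "\<lambda>t. - (exp (- t) * growing_mode t + cosh S * s t)"
          and f' = "\<lambda>t. (cosh S - exp (- t) * cosh (s t)) * v (s t) t"])
      show "continuous_on {0..t} (\<lambda>t. - (exp (- t) * growing_mode t + cosh S * s t))"
        by (intro continuous_intros continuous_on_subset[OF continuous_on_growing_mode]
            continuous_on_subset[OF continuous_on_s]) auto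
      fix \<tau> :: real assume \<tau>: "0 < \<tau>"
      show "((\<lambda>t. - (exp (- t) * growing_mode t + cosh S * s t)) has_real_derivative
          (cosh S - exp (- \<tau>) * cosh (s \<tau>)) * v (s \<tau>) \<tau>) (at_right \<tau>)"
        by (rule derivative_eq_intros growing_mode_deriv s_right_derivative refl \<tau> less_imp_le)+
          (simp add: algebra_simps)
      have "exp (- \<tau>) * cosh (s \<tau>) \<le> 1 * cosh S"
        using \<tau> s_less[of \<tau>] s_pos[of \<tau>]
        by (intro mult_mono) (auto simp: cosh_real_nonneg_le_iff cosh_real_nonneg)
      then show "(cosh S - exp (- \<tau>) * cosh (s \<tau>)) * v (s \<tau>) \<tau> \<le> 0"
        using outflow[of \<tau>] \<tau> by (intro mult_nonneg_nonpos) auto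
    qed (fact t)
    have "growing_mode 0 + cosh S * s 0 \<le> exp (- t) * growing_mode t + cosh S * s t"
      using decrease by simp
    moreover have "exp (- t) * growing_mode t \<le> b * exp (- t)"
      using b[OF t] by (simp add: abs_le_iff)
    moreover have "cosh S * s t \<le> cosh S * S"
      using s_less[OF t] by (intro mult_left_mono) (auto simp: cosh_real_nonneg)
    ultimately show ?thesis unfolding right_diff_distrib by argo
  qed
  then have "\<forall>\<^sub>F t in at_top. growing_mode 0 \<le> b * exp (- t) + cosh S * (S - s 0)"
    by (auto intro: eventually_mono[OF eventually_ge_at_top[of 0]])
  moreover have "((\<lambda>t :: real. b * exp (- t) + cosh S * (S - s 0)) \<longlongrightarrow> b * 0
      + cosh S * (S - s 0)) at_top"
    by (intro tendsto_intros filterlim_compose[OF exp_at_bot] filterlim_uminus_at_bot_at_top)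
  ultimately show ?thesis using tendsto_lowerbound by fastforce
qed

text \<open>
  The definition of the growing mode is solved for the initial flux.  The two bounds on the mode
  say that a large heat supply would melt past the target and a large extraction would undercool
  the liquid.
\<close>
lemma initial_input_sq_le:
  "(inflow 0)\<^sup>2
      \<le> 3 * ((mode_denom * cosh S)\<^sup>2 + 2 * (c * \<kappa>)\<^sup>2) * ((s 0 - S)\<^sup>2 + S ^ 3 * grad_energy 0)"
proof -
  let ?I = "integral {0..s 0} (\<lambda>x. u x 0)"
  have three: "(a + b + d)\<^sup>2 \<le> 3 * (a\<^sup>2 + b\<^sup>2 + d\<^sup>2)" for a b d :: real
    using sum_squares_bound[of a b] sum_squares_bound[of b d] sum_squares_bound[of a d]
    by (simp add: power2_eq_square algebra_simps)
  have "inflow 0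
      = mode_denom * growing_mode 0 + (- (mode_denom * cosh_moment 0)) + c * \<kappa> * enthalpy 0"
    using mode_denom_pos by (simp add: growing_mode_def field_simps)
  then have "(inflow 0)\<^sup>2
      \<le> 3 * ((mode_denom * growing_mode 0)\<^sup>2 + (mode_denom * cosh_moment 0)\<^sup>2
          + (c * \<kappa> * enthalpy 0)\<^sup>2)"
    using three[of "mode_denom * growing_mode 0" "- (mode_denom * cosh_moment 0)"
        "c * \<kappa> * enthalpy 0"] by simp
  moreover have "(mode_denom * growing_mode 0)\<^sup>2 \<le> (mode_denom * cosh S)\<^sup>2 * (s 0 - S)\<^sup>2"
  proof -
    have "(mode_denom * growing_mode 0)\<^sup>2 \<le> (mode_denom * (cosh S * (S - s 0)))\<^sup>2"
      using mode_denom_pos growing_mode_initial_nonneg growing_mode_initial_le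
        by (intro power_mono mult_left_mono) auto
    then show ?thesis by (simp add: power_mult_distrib power2_commute[of S])
  qed
  moreover have "(mode_denom * cosh_moment 0)\<^sup>2 \<le> (mode_denom * cosh S)\<^sup>2 * (S ^ 3 * grad_energy 0)"
  proof -
    have "(mode_denom * cosh_moment 0)\<^sup>2 \<le> (mode_denom * (cosh S * ?I))\<^sup>2"
      using mode_denom_pos cosh_moment_bounds[of 0] by (intro power_mono mult_left_mono) auto
    also have "\<dots> = (mode_denom * cosh S)\<^sup>2 * ?I\<^sup>2" by (simp add: power_mult_distrib)
    also have "\<dots> \<le> (mode_denom * cosh S)\<^sup>2 * (S ^ 3 * grad_energy 0)"
      using heat_content_sq_le[of 0] by (intro mult_left_mono) auto
    finally show ?thesis .
  qed
  moreover have "(c * \<kappa> * enthalpy 0)\<^sup>2 \<le> (c * \<kappa>)\<^sup>2 * (2 * (s 0 - S)\<^sup>2 + 2 * S ^ 3 * grad_energy 0)"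
    unfolding power_mult_distrib[of "c * \<kappa>"] using enthalpy_sq_le[of 0]
      by (intro mult_left_mono) auto
  ultimately have "(inflow 0)\<^sup>2
      \<le> 3 * ((mode_denom * cosh S)\<^sup>2 * (s 0 - S)\<^sup>2
          + (mode_denom * cosh S)\<^sup>2 * (S ^ 3 * grad_energy 0)
      + (c * \<kappa>)\<^sup>2 * (2 * (s 0 - S)\<^sup>2 + 2 * S ^ 3 * grad_energy 0))"
    by argo
  then show ?thesis by (simp add: algebra_simps)
qed

end

section \<open>Exponential stability\<close>

text \<open>
  The constants depend on \<open>S\<close>, \<open>c\<close> and \<open>\<kappa>\<close> only, not on the solution.  On the right-hand side the
  gradient energy suffices, since it dominates the integral of \<open>u\<^sup>2\<close>.
\<close>
theorem uniform_exponential_stability: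
  fixes S c \<kappa> :: real
  assumes "0 < S" "0 < c" "0 < \<kappa>"
  obtains M n where "0 < M" "0 < n"
    "\<And>s u v w t. stefan_closed_loop s u v w S c \<kappa> \<Longrightarrow> 0 \<le> t \<Longrightarrow>
      integral {0..s t} (\<lambda>x. (u x t)\<^sup>2) + integral {0..s t} (\<lambda>x. (v x t)\<^sup>2) + (s t - S)\<^sup>2
      \<le> M * (integral {0..s 0} (\<lambda>x. (v x 0)\<^sup>2) + (s 0 - S)\<^sup>2) * exp (- n * t)"
proof -
  \<comment> \<open>Each summand of \<open>A\<close> and of \<open>B\<close> meets one of the bounds that the Lyapunov estimate requires.\<close>
  define A where "A = 4 * (2 * S + 1) + (2 / S + 4 * c\<^sup>2 * S ^ 3 + 1) / c
    + (4 * c\<^sup>2 * S ^ 3 * \<kappa>\<^sup>2 + 1) / (c\<^sup>2 * \<kappa>) + 1 / (c\<^sup>2 / 6 + c * \<kappa>)"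
  have summands: "0 \<le> 4 * (2 * S + 1)" "0 \<le> (2 / S + 4 * c\<^sup>2 * S ^ 3 + 1) / c"
    "0 \<le> (4 * c\<^sup>2 * S ^ 3 * \<kappa>\<^sup>2 + 1) / (c\<^sup>2 * \<kappa>)" "0 \<le> 1 / (c\<^sup>2 / 6 + c * \<kappa>)"
    using assms by auto
  have den: "0 < c\<^sup>2 * \<kappa>" "0 < c\<^sup>2 / 6 + c * \<kappa>" using assms by (auto intro: add_pos_pos)
  have "(2 / S + 4 * c\<^sup>2 * S ^ 3 + 1) / c \<le> A" "(4 * c\<^sup>2 * S ^ 3 * \<kappa>\<^sup>2 + 1) / (c\<^sup>2 * \<kappa>) \<le> A"
    "1 / (c\<^sup>2 / 6 + c * \<kappa>) \<le> A" "4 * (2 * S + 1) \<le> A" "0 \<le> A"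
    using summands unfolding A_def by linarith+
  note bounds = this
  have A: "0 \<le> A" "2 * S + 1 \<le> A / 4" "2 / S + 4 * c\<^sup>2 * S ^ 3 + 1 \<le> A * c"
      "4 * c\<^sup>2 * S ^ 3 * \<kappa>\<^sup>2 + 1 \<le> A * (c\<^sup>2 * \<kappa>)" "1 \<le> A * (c\<^sup>2 / 6 + c * \<kappa>)"
    using bounds(4,5) bounds(1-3)[unfolded pos_divide_le_eq[OF \<open>0 < c\<close>] pos_divide_le_eq[OF den(1)]
        pos_divide_le_eq[OF den(2)]] by simp_all
  define B where "B = 3 / 2 + A * (3 / 2) + 2 * S + A * (c * \<kappa> + c\<^sup>2)"
  have "0 \<le> A * (c * \<kappa> + c\<^sup>2)" using A(1) assms by simp
  then have B: "3 / 2 \<le> B" "A * (3 / 2) + 2 * S \<le> B" "A * (c * \<kappa> + c\<^sup>2) \<le> B"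
    using A(1) assms unfolding B_def by auto
  define m where "m = min 1 (1 / (2 * S\<^sup>2))"
  have m: "0 < m" "m \<le> 1" "m \<le> 1 / (2 * S\<^sup>2)" using assms by (auto simp: m_def)
  \<comment> \<open>\<open>K\<close> bounds the initial inflow and \<open>R\<close> the initial state size, by displacement and gradient.\<close>
  define K where "K = 3 * (((1 + c + c * \<kappa>) * cosh S)\<^sup>2 + 2 * (c * \<kappa>)\<^sup>2)"
  have K: "0 \<le> K" by (simp add: K_def)
  define C where "C = 3 + S\<^sup>2 + 2 * S ^ 3"
  define R where "R = 1 + (K + 2) * (1 + S ^ 3)"
  have C: "0 < C" "0 \<le> S ^ 3" "0 < R"
    using assms K by (auto simp: C_def R_def intro!: add_pos_nonneg)
  show ?thesis
  proof
    show "0 < C * (2 * B) * R" using C B(1) by simp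
    show "0 < m / B" using m B(1) by simp
    fix s u v w t
    assume "stefan_closed_loop s u v w S c \<kappa>" and t: "0 \<le> (t :: real)"
    then interpret stefan_closed_loop s u v w S c \<kappa> by simp
    have "integral {0..s t} (\<lambda>x. (u x t)\<^sup>2) + grad_energy t + (s t - S)\<^sup>2
        \<le> S\<^sup>2 * grad_energy t + grad_energy t + (2 * (enthalpy t)\<^sup>2 + 2 * S ^ 3 * grad_energy t)"
      using integral_u_sq_le[OF t] displacement_sq_le[OF t] by simp
    also have "\<dots> \<le> C * state_size t"
    proof -
      have "0 \<le> 2 * grad_energy t + C * (inflow t)\<^sup>2 + (1 + S\<^sup>2 + 2 * S ^ 3) * (enthalpy t)\<^sup>2"
        using grad_energy_nonneg[OF t] C by (intro add_nonneg_nonneg mult_nonneg_nonneg) auto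
      then show ?thesis by (simp add: state_size_def C_def algebra_simps)
    qed
    also have "\<dots> \<le> C * (2 * B * state_size 0 * exp (- (m / B) * t))"
      using lyapunov_decay[OF A B m t] C by (intro mult_left_mono) auto
    also have "\<dots> = C * (2 * B) * state_size 0 * exp (- (m / B) * t)" by simp
    also have "\<dots> \<le> C * (2 * B) * (R * (grad_energy 0 + (s 0 - S)\<^sup>2)) * exp (- (m / B) * t)"
    proof (intro mult_right_mono mult_left_mono)
      let ?X = "(s 0 - S)\<^sup>2 + S ^ 3 * grad_energy 0"
      have J0: "0 \<le> grad_energy 0" by (rule grad_energy_nonneg) simp
      have "(inflow 0)\<^sup>2 \<le> K * ?X" using initial_input_sq_le by (simp add: K_def mode_denom_def)
      moreover have "(enthalpy 0)\<^sup>2 \<le> 2 * ?X" using enthalpy_sq_le[of 0] by simp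
      ultimately have "state_size 0 \<le> grad_energy 0 + (K + 2) * ?X" unfolding state_size_def
        by (simp add: algebra_simps)
      also have "(K + 2) * ?X \<le> (K + 2) * ((1 + S ^ 3) * (grad_energy 0 + (s 0 - S)\<^sup>2))"
        using K J0 C(2) by (intro mult_left_mono) (auto simp: algebra_simps)
      also have "grad_energy 0 + \<dots> \<le> R * (grad_energy 0 + (s 0 - S)\<^sup>2)"
        by (simp add: R_def algebra_simps)
      finally show "state_size 0 \<le> R * (grad_energy 0 + (s 0 - S)\<^sup>2)" by simp
    qed (use C B(1) in auto)
    finally show "integral {0..s t} (\<lambda>x. (u x t)\<^sup>2) + integral {0..s t} (\<lambda>x. (v x t)\<^sup>2)
        + (s t - S)\<^sup>2
      \<le> C * (2 * B) * R * (integral {0..s 0} (\<lambda>x. (v x 0)\<^sup>2) + (s 0 - S)\<^sup>2) * exp (- (m / B) * t)"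
      by (simp add: grad_energy_def mult.assoc)
  qed
qed

text \<open>
  The compatibility of the data supplies the Dirichlet condition at the initial time, and the
  flux equation of the averaged system is itself the feedback law for \<open>- U\<close>.  A positive
  interface speed is, by the Stefan condition, a negative temperature gradient at the interface.
\<close>
lemma closed_loop_of_average_system:
  assumes "H < 0" "K < 0" "0 < c"
    and loop: "average_closed_loop H K \<Theta> c \<theta> u"
    and compatible: "compatible_initial_data (s_av \<Theta> \<theta>) u U"
    and valid: "model_validity Tm \<Theta> (s_av \<Theta> \<theta>) u"
  shows "stefan_closed_loop (s_av \<Theta> \<theta>) u (space_deriv (s_av \<Theta> \<theta>) u)
    (space_deriv (s_av \<Theta> \<theta>) (space_deriv (s_av \<Theta> \<theta>) u)) \<Theta> c (K * H)"
proof -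
  let ?s = "s_av \<Theta> \<theta>"
  note L = loop[unfolded average_closed_loop_def Let_def]
  note R = L[THEN conjunct1, unfolded classical_regularity_def]
  note F = valid[unfolded model_validity_def T_av_def]
  have pos: "0 < ?s t" if "0 \<le> t" for t using R that by blast
  have s_deriv: "(?s has_real_derivative - space_deriv ?s u (?s t) t) (at t within {0..})"
    if "0 \<le> t" for t
    using L that unfolding s_av_def[abs_def] by (auto intro!: derivative_eq_intros)
  have space: "((\<lambda>y. f y t) has_real_derivative space_deriv ?s f x t) (at x within {0..?s t})"
    if "(\<lambda>y. f y t) differentiable_on {0..?s t}" "x \<in> {0..?s t}" for f t x
    using that
    unfolding space_deriv_def has_real_derivative_iff_has_vector_derivative differentiable_on_def
    by (intro vector_derivative_works[THEN iffD1]) blast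
  show ?thesis
  proof
    show "0 < c" "0 < K * H" using assms by (auto simp: mult_neg_neg)
    fix t :: real
    show "space_deriv ?s u (?s t) t < 0" if t: "0 \<le> t"
    proof -
      have "vector_derivative ?s (at t within {0..}) = - space_deriv ?s u (?s t) t"
      proof (rule vector_derivative_within)
        show "at t within {0..} \<noteq> bot"
          using t at_le[of "{t<..}" "{0..}" t] trivial_limit_at_right_real[of t]
          by (auto simp: bot_unique subset_iff)
      qed (use s_deriv[OF t] in \<open>simp add: has_real_derivative_iff_has_vector_derivative\<close>)
      then show ?thesis using F t by auto
    qed
    show "u (?s t) t = 0" if "0 \<le> t"
      using that L compatible unfolding compatible_initial_data_def by (cases "t = 0") auto
    show "?s t < \<Theta>" if "0 \<le> t" using that F by (cases "t = 0") auto
    show "0 < u x t" if "0 \<le> t" "x \<in> {0<..<?s t}" for x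
    proof -
      have "Tm + u x t > Tm" using F that by blast
      then show ?thesis by simp
    qed
    show "((\<lambda>\<tau>. space_deriv ?s u 0 \<tau>) has_real_derivative - c * space_deriv ?s u 0 t
        + c * (K * H) * ((?s t - \<Theta>) + integral {0..?s t} (\<lambda>x. u x t))) (at t within {0..})"
      if "0 \<le> t"
      using L that by (simp add: s_av_def mult.assoc)
    show "0 < ?s t" if "0 \<le> t" by (fact pos[OF that])
    show "(?s has_real_derivative - space_deriv ?s u (?s t) t) (at t within {0..})" if "0 \<le> t"
      by (fact s_deriv[OF that])
    show "((\<lambda>y. u y t) has_real_derivative space_deriv ?s u x t) (at x within {0..?s t})"
      if "0 \<le> t" "x \<in> {0..?s t}" for x
      using R that by (intro space) auto
    show "((\<lambda>y. space_deriv ?s u y t) has_real_derivative space_deriv ?s (space_deriv ?s u) x t)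
        (at x within {0..?s t})" if "0 < t" "x \<in> {0..?s t}" for x
      using R that by (intro space) auto
    show "(u x has_real_derivative space_deriv ?s (space_deriv ?s u) x t) (at t)"
      if "0 < t" "x \<in> {0<..<?s t}" for x
      using L that by auto
  qed (use R in simp_all)
qed

theorem theorem1:
  fixes H K \<Theta>_star s_star Tm :: real
  assumes "H < 0" and "K < 0" and "\<Theta>_star > 0" and "s_star = \<Theta>_star"
  shows "\<exists>c0>0. \<forall>c>c0. \<exists>M>0. \<exists>n>0.
    \<forall>(\<theta> :: real \<Rightarrow> real) (u :: real \<Rightarrow> real \<Rightarrow> real) (U :: real \<Rightarrow> real).
      average_closed_loop H K \<Theta>_star c \<theta> u \<longrightarrow>
      filtered_control H K c (s_av \<Theta>_star \<theta>) \<theta> u U \<longrightarrow>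
      compatible_initial_data (s_av \<Theta>_star \<theta>) u U \<longrightarrow>
      model_validity Tm s_star (s_av \<Theta>_star \<theta>) u \<longrightarrow>
      (\<forall>t\<ge>0. H1_norm_sq (s_av \<Theta>_star \<theta>) u t + \<bar>\<theta> t\<bar>\<^sup>2
          \<le> M * (H1_norm_sq (s_av \<Theta>_star \<theta>) u 0 + (\<theta> 0)\<^sup>2) * exp (- n * t))"
  \<comment> \<open>The decay estimate is available for every positive \<open>c\<close>; \<open>1\<close> serves as the threshold.\<close>
proof (rule exI[of _ "1::real"], intro conjI allI impI)
  fix c :: real assume "1 < c"
  then have "0 < c" by simp
  have "0 < K * H" using assms by (simp add: mult_neg_neg)
  obtain M n where M: "0 < M" and n: "0 < n" and decay:
    "\<And>s u v w t. stefan_closed_loop s u v w \<Theta>_star c (K * H) \<Longrightarrow> 0 \<le> t \<Longrightarrow>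
      integral {0..s t} (\<lambda>x. (u x t)\<^sup>2) + integral {0..s t} (\<lambda>x. (v x t)\<^sup>2) + (s t - \<Theta>_star)\<^sup>2
      \<le> M * (integral {0..s 0} (\<lambda>x. (v x 0)\<^sup>2) + (s 0 - \<Theta>_star)\<^sup>2) * exp (- n * t)"
    using uniform_exponential_stability[OF \<open>\<Theta>_star > 0\<close> \<open>0 < c\<close> \<open>0 < K * H\<close>] by blast
  show "\<exists>M>0. \<exists>n>0.
    \<forall>(\<theta> :: real \<Rightarrow> real) (u :: real \<Rightarrow> real \<Rightarrow> real) (U :: real \<Rightarrow> real).
      average_closed_loop H K \<Theta>_star c \<theta> u \<longrightarrow>
      filtered_control H K c (s_av \<Theta>_star \<theta>) \<theta> u U \<longrightarrow>
      compatible_initial_data (s_av \<Theta>_star \<theta>) u U \<longrightarrow>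
      model_validity Tm s_star (s_av \<Theta>_star \<theta>) u \<longrightarrow>
      (\<forall>t\<ge>0. H1_norm_sq (s_av \<Theta>_star \<theta>) u t + \<bar>\<theta> t\<bar>\<^sup>2
          \<le> M * (H1_norm_sq (s_av \<Theta>_star \<theta>) u 0 + (\<theta> 0)\<^sup>2) * exp (- n * t))"
  proof (rule exI[of _ M], intro exI[of _ n] conjI M n allI impI)
    fix \<theta> :: "real \<Rightarrow> real" and u :: "real \<Rightarrow> real \<Rightarrow> real" and U :: "real \<Rightarrow> real" and t :: real
    assume loop: "average_closed_loop H K \<Theta>_star c \<theta> u"
      and compatible: "compatible_initial_data (s_av \<Theta>_star \<theta>) u U"
      and valid: "model_validity Tm s_star (s_av \<Theta>_star \<theta>) u" and t: "0 \<le> t"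
    let ?s = "s_av \<Theta>_star \<theta>"
    interpret stefan_closed_loop ?s u "space_deriv ?s u" "space_deriv ?s (space_deriv ?s u)"
      \<Theta>_star c "K * H"
      using closed_loop_of_average_system[OF \<open>H < 0\<close> \<open>K < 0\<close> \<open>0 < c\<close> loop compatible] valid
        \<open>s_star = \<Theta>_star\<close> by simp
    have "H1_norm_sq ?s u t + \<bar>\<theta> t\<bar>\<^sup>2 \<le> M * (grad_energy 0 + (\<theta> 0)\<^sup>2) * exp (- n * t)"
      using decay[OF stefan_closed_loop_axioms t]
        by (simp add: H1_norm_sq_def grad_energy_def s_av_def)
    also have "\<dots> \<le> M * (H1_norm_sq ?s u 0 + (\<theta> 0)\<^sup>2) * exp (- n * t)"
    proof -
      have "0 \<le> integral {0..?s 0} (\<lambda>x. (u x 0)\<^sup>2)"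
        by (intro integral_nonneg integrable_continuous_interval continuous_intros slice_u) auto
      then have "grad_energy 0 \<le> H1_norm_sq ?s u 0" by (simp add: H1_norm_sq_def grad_energy_def)
      then show ?thesis using M by (intro mult_right_mono mult_left_mono) auto
    qed
    finally show "H1_norm_sq ?s u t + \<bar>\<theta> t\<bar>\<^sup>2
        \<le> M * (H1_norm_sq ?s u 0 + (\<theta> 0)\<^sup>2) * exp (- n * t)" .
  qed
qed simp

end
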